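(* Let $\gamma:I\to\mathbb{G}$ be a unit speed Frenet curve with Frenet-Serret apparatus $\{T,N,B,\kappa,\tau\}$ and Lie group torsion $\tau_{\mathbb G}=\frac12\langle[T,N],B\rangle$, and assume $\tau-\tau_{\mathbb G}\neq0$. A unit speed curve $\gamma^*:I\to\mathbb{G}$ with Frenet-Serret apparatus $\{T^*,N^*,B^*,\kappa^*,\tau^*\}$ is the conjugate mate of $\gamma$ if and only if $$T^*=B,\qquad N^*=-\operatorname{sign}(\tau-\tau_{\mathbb G})N,\qquad B^*=\operatorname{sign}(\tau-\tau_{\mathbb G})T,$$ $$\kappa^*=|\tau-\tau_{\mathbb G}|,\qquad \tau^*-\tau_{\mathbb G}^*=\kappa,\qquad \tau^*=\kappa+\tau_{\mathbb G},$$ where $\tau_{\mathbb G}^*=\frac12\langle[T^*,N^*],B^*\rangle$.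
   Context: Let $\mathbb{G}$ be a three-dimensional Lie group with a bi-invariant Riemannian metric $\langle\cdot,\cdot\rangle$, with (oriented) Lie algebra $\mathfrak g$ and Levi-Civita connection $\nabla$; $I\subset\mathbb R$ is an interval and curves are smooth. Vector fields along a curve in $\mathbb G$ are identified with $\mathfrak g$-valued maps by left translation: fixing an orthonormal basis $X_1,X_2,X_3$ of left-invariant fields, write $U=\sum u_iX_i$, and set $U'=\sum u_i'X_i$, $[U,V]=\sum u_iv_j[X_i,X_j]$; then $\nabla_TU=U'+\frac12[T,U]$ with $T=\gamma'$. Vector fields along different curves with the same parameter interval are compared as $\mathfrak g$-valued maps. A unit speed curve $\gamma$ has Frenet-Serret apparatus $\{T,N,B,\kappa,\tau\}$ if $\kappa=\|\nabla_TT\|>0$, $(T,N,B)$ is a positively oriented orthonormal frame, and $\nabla_TT=\kappa N$, $\nabla_TN=-\kappa T+\tau B$, $\nabla_TB=-\tau N$. It is a Frenet curve if moreover $\tau\neq0$. A unit speed curve $\gamma^*:I\to\mathbb G$ with Frenet-Serret apparatus $\{T^*,N^*,B^*,\kappa^*,\tau^*\}$ is the conjugate mate of $\gamma$ if $T^*=B$. The condition $\tau-\tau_{\mathbb G}\ne0$ is meant at every point of $I$. *)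

theory Defs
  imports "HOL-Analysis.Analysis" "HOL-Algebra.Group"
begin

section \<open>Smooth maps between subsets of Euclidean spaces\<close>

text \<open>
  Only used on sets where the derivative within the set is unique: open subsets of a
  Euclidean space, and relatively open subsets of a nondegenerate interval (where the
  derivatives at an endpoint of the interval are one-sided).
\<close>

primrec Ck_on :: "nat \<Rightarrow> 'a::euclidean_space set \<Rightarrow> ('a \<Rightarrow> 'b::real_normed_vector) \<Rightarrow> bool" where
  "Ck_on 0 S f \<longleftrightarrow> continuous_on S f"
| "Ck_on (Suc k) S f \<longleftrightarrow>
     f differentiable_on S \<and> (\<forall>v. Ck_on k S (\<lambda>x. frechet_derivative f (at x within S) v))"

definition smooth_on :: "'a::euclidean_space set \<Rightarrow> ('a \<Rightarrow> 'b::real_normed_vector) \<Rightarrow> bool" where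
  "smooth_on S f \<longleftrightarrow> (\<forall>k. Ck_on k S f)"


section \<open>Smooth manifolds\<close>

text \<open>
  A chart is a domain together with a coordinate map; the values of the coordinate map
  outside the domain are irrelevant.  Atlases are not required to be maximal.
\<close>

type_synonym ('a, 'e) chart = "'a set \<times> ('a \<Rightarrow> 'e)"

definition chart_inv :: "('a, 'e) chart \<Rightarrow> 'e \<Rightarrow> 'a" where
  "chart_inv c = inv_into (fst c) (snd c)"

definition local_rep :: "('a \<Rightarrow> 'b) \<Rightarrow> ('a, 'e) chart \<Rightarrow> ('b, 'f) chart \<Rightarrow> 'e \<Rightarrow> 'f" where
  "local_rep f c d = snd d \<circ> f \<circ> chart_inv c"

definition smooth_manifold :: "'a topology \<Rightarrow> ('a, 'e::euclidean_space) chart set \<Rightarrow> bool" where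
  "smooth_manifold X A \<longleftrightarrow>
     Hausdorff_space X \<and> second_countable X \<and>
     (\<Union>c\<in>A. fst c) = topspace X \<and>
     (\<forall>c\<in>A. openin X (fst c) \<and> open (snd c ` fst c) \<and>
        homeomorphic_map (subtopology X (fst c)) (top_of_set (snd c ` fst c)) (snd c)) \<and>
     (\<forall>c\<in>A. \<forall>d\<in>A. smooth_on (snd c ` (fst c \<inter> fst d)) (local_rep id c d))"

definition smooth_map ::
    "'a topology \<Rightarrow> ('a, 'e::euclidean_space) chart set \<Rightarrow>
     'b topology \<Rightarrow> ('b, 'f::euclidean_space) chart set \<Rightarrow> ('a \<Rightarrow> 'b) \<Rightarrow> bool" where
  "smooth_map X A Y B f \<longleftrightarrow>
     continuous_map X Y f \<and>
     (\<forall>c\<in>A. \<forall>d\<in>B. smooth_on (snd c ` {p \<in> fst c. f p \<in> fst d}) (local_rep f c d))"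

definition smooth_fun :: "('a, 'e::euclidean_space) chart set \<Rightarrow> ('a \<Rightarrow> real) \<Rightarrow> bool" where
  "smooth_fun A f \<longleftrightarrow> (\<forall>c\<in>A. smooth_on (snd c ` fst c) (f \<circ> chart_inv c))"

definition prod_atlas ::
    "('a, 'e) chart set \<Rightarrow> ('b, 'f) chart set \<Rightarrow> ('a \<times> 'b, 'e \<times> 'f) chart set" where
  "prod_atlas A B = {(fst c \<times> fst d, map_prod (snd c) (snd d)) | c d. c \<in> A \<and> d \<in> B}"


section \<open>Tangent vectors and vector fields\<close>

text \<open>
  A tangent vector at \<open>p\<close> is the family of its coordinate vectors in all charts around \<open>p\<close>,
  related by the derivatives of the chart changes.  The entries for all other charts are
  set to zero, so that equality of functions is equality of tangent vectors, and the tangent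
  space at a point outside the manifold is trivial.
\<close>

type_synonym ('a, 'e) tvec = "('a, 'e) chart \<Rightarrow> 'e"

type_synonym ('a, 'e) vfield = "'a \<Rightarrow> ('a, 'e) tvec"

definition charts_at :: "('a, 'e) chart set \<Rightarrow> 'a \<Rightarrow> ('a, 'e) chart set" where
  "charts_at A p = {c \<in> A. p \<in> fst c}"

definition tangent_space ::
    "('a, 'e::euclidean_space) chart set \<Rightarrow> 'a \<Rightarrow> ('a, 'e) tvec set" where
  "tangent_space A p =
     {v. (\<forall>c\<in>charts_at A p. \<forall>d\<in>charts_at A p.
            v d = frechet_derivative (local_rep id c d) (at (snd c p)) (v c)) \<and>
         (\<forall>c. c \<notin> charts_at A p \<longrightarrow> v c = 0)}"

text \<open>The choice of the chart \<open>c\<close> below is immaterial for smooth \<open>f\<close> and tangent vectors \<open>v\<close>.\<close>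

definition differential ::
    "('a, 'e::euclidean_space) chart set \<Rightarrow> ('b, 'f::euclidean_space) chart set \<Rightarrow>
     ('a \<Rightarrow> 'b) \<Rightarrow> 'a \<Rightarrow> ('a, 'e) tvec \<Rightarrow> ('b, 'f) tvec" where
  "differential A B f p v =
     (\<lambda>d. if d \<in> charts_at B (f p)
          then let c = (SOME c. c \<in> charts_at A p)
               in frechet_derivative (local_rep f c d) (at (snd c p)) (v c)
          else 0)"

definition field_rep :: "('a, 'e) vfield \<Rightarrow> ('a, 'e) chart \<Rightarrow> 'e \<Rightarrow> 'e" where
  "field_rep V c = (\<lambda>x. V (chart_inv c x) c)"

definition vector_fields :: "('a, 'e::euclidean_space) chart set \<Rightarrow> ('a, 'e) vfield set" where
  "vector_fields A =
     {V. (\<forall>p. V p \<in> tangent_space A p) \<and>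
         (\<forall>c\<in>A. smooth_on (snd c ` fst c) (field_rep V c))}"

definition vf_add ::
    "('a, 'e::euclidean_space) vfield \<Rightarrow> ('a, 'e) vfield \<Rightarrow> ('a, 'e) vfield" where
  "vf_add V W = (\<lambda>p c. V p c + W p c)"

definition vf_scale ::
    "('a \<Rightarrow> real) \<Rightarrow> ('a, 'e::euclidean_space) vfield \<Rightarrow> ('a, 'e) vfield" where
  "vf_scale f V = (\<lambda>p c. f p *\<^sub>R V p c)"

definition vf_deriv ::
    "('a, 'e::euclidean_space) chart set \<Rightarrow> ('a, 'e) vfield \<Rightarrow> ('a \<Rightarrow> real) \<Rightarrow> 'a \<Rightarrow> real" where
  "vf_deriv A V f p =
     (let c = (SOME c. c \<in> charts_at A p)
      in frechet_derivative (f \<circ> chart_inv c) (at (snd c p)) (V p c))"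

text \<open>
  In coordinates \<open>[V, W] = DW \<cdot> V - DV \<cdot> W\<close>, so that
  \<open>[V, W] f = V (W f) - W (V f)\<close>.
\<close>

definition lie_bracket ::
    "('a, 'e::euclidean_space) chart set \<Rightarrow> ('a, 'e) vfield \<Rightarrow> ('a, 'e) vfield \<Rightarrow> ('a, 'e) vfield"
  where
  "lie_bracket A V W = (\<lambda>p c.
     if c \<in> charts_at A p
     then frechet_derivative (field_rep W c) (at (snd c p)) (V p c)
        - frechet_derivative (field_rep V c) (at (snd c p)) (W p c)
     else 0)"


section \<open>Riemannian metrics and the Levi-Civita connection\<close>

type_synonym ('a, 'e) metric = "'a \<Rightarrow> ('a, 'e) tvec \<Rightarrow> ('a, 'e) tvec \<Rightarrow> real"

definition riemannian_metric ::
    "'a topology \<Rightarrow> ('a, 'e::euclidean_space) chart set \<Rightarrow> ('a, 'e) metric \<Rightarrow> bool" where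
  "riemannian_metric X A g \<longleftrightarrow>
     (\<forall>p\<in>topspace X. \<forall>u\<in>tangent_space A p. \<forall>v\<in>tangent_space A p. \<forall>w\<in>tangent_space A p. \<forall>a b.
        g p u v = g p v u \<and>
        g p (\<lambda>c. a *\<^sub>R u c + b *\<^sub>R v c) w = a * g p u w + b * g p v w) \<and>
     (\<forall>p\<in>topspace X. \<forall>v\<in>tangent_space A p. v \<noteq> (\<lambda>c. 0) \<longrightarrow> g p v v > 0) \<and>
     (\<forall>V\<in>vector_fields A. \<forall>W\<in>vector_fields A. smooth_fun A (\<lambda>p. g p (V p) (W p)))"

type_synonym ('a, 'e) connection = "('a, 'e) vfield \<Rightarrow> ('a, 'e) vfield \<Rightarrow> ('a, 'e) vfield"

definition affine_connection ::
    "('a, 'e::euclidean_space) chart set \<Rightarrow> ('a, 'e) connection \<Rightarrow> bool" where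
  "affine_connection A D \<longleftrightarrow>
     (\<forall>V\<in>vector_fields A. \<forall>W\<in>vector_fields A. D V W \<in> vector_fields A) \<and>
     (\<forall>V\<in>vector_fields A. \<forall>V'\<in>vector_fields A. \<forall>W\<in>vector_fields A.
        D (vf_add V V') W = vf_add (D V W) (D V' W)) \<and>
     (\<forall>V\<in>vector_fields A. \<forall>W\<in>vector_fields A. \<forall>W'\<in>vector_fields A.
        D V (vf_add W W') = vf_add (D V W) (D V W')) \<and>
     (\<forall>f. smooth_fun A f \<longrightarrow> (\<forall>V\<in>vector_fields A. \<forall>W\<in>vector_fields A.
        D (vf_scale f V) W = vf_scale f (D V W) \<and>
        D V (vf_scale f W) = vf_add (vf_scale (vf_deriv A V f) W) (vf_scale f (D V W))))"

definition levi_civita ::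
    "'a topology \<Rightarrow> ('a, 'e::euclidean_space) chart set \<Rightarrow> ('a, 'e) metric \<Rightarrow>
     ('a, 'e) connection \<Rightarrow> bool" where
  "levi_civita X A g D \<longleftrightarrow>
     affine_connection A D \<and>
     (\<forall>V\<in>vector_fields A. \<forall>W\<in>vector_fields A. \<forall>p c.
        D V W p c - D W V p c = lie_bracket A V W p c) \<and>
     (\<forall>V\<in>vector_fields A. \<forall>W\<in>vector_fields A. \<forall>Z\<in>vector_fields A. \<forall>p\<in>topspace X.
        vf_deriv A V (\<lambda>q. g q (W q) (Z q)) p = g p (D V W p) (Z p) + g p (W p) (D V Z p))"


section \<open>Lie groups, bi-invariant metrics and left-invariant frames\<close>

definition lie_group ::
    "('a, 'b) monoid_scheme \<Rightarrow> 'a topology \<Rightarrow> ('a, 'e::euclidean_space) chart set \<Rightarrow> bool" where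
  "lie_group G X A \<longleftrightarrow>
     group G \<and> topspace X = carrier G \<and> smooth_manifold X A \<and>
     smooth_map (prod_topology X X) (prod_atlas A A) X A (\<lambda>(p, q). p \<otimes>\<^bsub>G\<^esub> q) \<and>
     smooth_map X A X A (\<lambda>p. inv\<^bsub>G\<^esub> p)"

definition biinvariant_metric ::
    "('a, 'b) monoid_scheme \<Rightarrow> 'a topology \<Rightarrow> ('a, 'e::euclidean_space) chart set \<Rightarrow>
     ('a, 'e) metric \<Rightarrow> bool" where
  "biinvariant_metric G X A g \<longleftrightarrow>
     riemannian_metric X A g \<and>
     (\<forall>a\<in>carrier G. \<forall>p\<in>carrier G. \<forall>v\<in>tangent_space A p. \<forall>w\<in>tangent_space A p.
        g (a \<otimes>\<^bsub>G\<^esub> p) (differential A A (\<lambda>q. a \<otimes>\<^bsub>G\<^esub> q) p v) (differential A A (\<lambda>q. a \<otimes>\<^bsub>G\<^esub> q) p w)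
          = g p v w \<and>
        g (p \<otimes>\<^bsub>G\<^esub> a) (differential A A (\<lambda>q. q \<otimes>\<^bsub>G\<^esub> a) p v) (differential A A (\<lambda>q. q \<otimes>\<^bsub>G\<^esub> a) p w)
          = g p v w)"

definition left_invariant ::
    "('a, 'b) monoid_scheme \<Rightarrow> ('a, 'e::euclidean_space) chart set \<Rightarrow> ('a, 'e) vfield \<Rightarrow> bool" where
  "left_invariant G A V \<longleftrightarrow>
     V \<in> vector_fields A \<and>
     (\<forall>a\<in>carrier G. \<forall>p\<in>carrier G.
        V (a \<otimes>\<^bsub>G\<^esub> p) = differential A A (\<lambda>q. a \<otimes>\<^bsub>G\<^esub> q) p (V p))"

text \<open>
  From here on the dimension is three.  An orthonormal basis \<open>E\<close> of left-invariant fields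
  identifies the Lie algebra with \<^typ>\<open>real^3\<close>: the vector \<open>u\<close> stands for
  \<open>\<Sum>i. u\<^sub>i E\<^sub>i\<close>, the metric becomes the standard inner product, and the Lie
  algebra is oriented by declaring \<open>E\<close> to be positively oriented.
\<close>

definition orthonormal_left_invariant_basis ::
    "('a, 'b) monoid_scheme \<Rightarrow> ('a, real^3) chart set \<Rightarrow> ('a, real^3) metric \<Rightarrow>
     (3 \<Rightarrow> ('a, real^3) vfield) \<Rightarrow> bool" where
  "orthonormal_left_invariant_basis G A g E \<longleftrightarrow>
     (\<forall>i. left_invariant G A (E i)) \<and>
     (\<forall>p\<in>carrier G. \<forall>i j. g p (E i p) (E j p) = (if i = j then 1 else 0))"

definition frame_vec ::
    "(3 \<Rightarrow> ('a, real^3) vfield) \<Rightarrow> 'a \<Rightarrow> real^3 \<Rightarrow> ('a, real^3) tvec" where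
  "frame_vec E p u = (\<lambda>c. \<Sum>i\<in>UNIV. (u $ i) *\<^sub>R E i p c)"

text \<open>
  The coordinates of \<open>\<Sum>i j. u\<^sub>i v\<^sub>j [E\<^sub>i, E\<^sub>j]\<close>.  The field \<open>[E\<^sub>i, E\<^sub>j]\<close> is
  left-invariant, so its coordinates can be read off at the identity.
\<close>

definition alg_bracket ::
    "('a, 'b) monoid_scheme \<Rightarrow> ('a, real^3) chart set \<Rightarrow> ('a, real^3) metric \<Rightarrow>
     (3 \<Rightarrow> ('a, real^3) vfield) \<Rightarrow> real^3 \<Rightarrow> real^3 \<Rightarrow> real^3" where
  "alg_bracket G A g E u v =
     (\<chi> k. \<Sum>i\<in>UNIV. \<Sum>j\<in>UNIV.
        u $ i * v $ j * g \<one>\<^bsub>G\<^esub> (lie_bracket A (E i) (E j) \<one>\<^bsub>G\<^esub>) (E k \<one>\<^bsub>G\<^esub>))"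


section \<open>Curves\<close>

definition nondegenerate_interval :: "real set \<Rightarrow> bool" where
  "nondegenerate_interval I \<longleftrightarrow> is_interval I \<and> (\<exists>a\<in>I. \<exists>b\<in>I. a < b)"

definition smooth_curve ::
    "'a topology \<Rightarrow> ('a, 'e::euclidean_space) chart set \<Rightarrow> real set \<Rightarrow> (real \<Rightarrow> 'a) \<Rightarrow> bool" where
  "smooth_curve X A I \<gamma> \<longleftrightarrow>
     continuous_map (top_of_set I) X \<gamma> \<and>
     (\<forall>c\<in>A. smooth_on {t \<in> I. \<gamma> t \<in> fst c} (snd c \<circ> \<gamma>))"

definition velocity ::
    "('a, 'e::euclidean_space) chart set \<Rightarrow> real set \<Rightarrow> (real \<Rightarrow> 'a) \<Rightarrow> real \<Rightarrow> ('a, 'e) tvec" where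
  "velocity A I \<gamma> t =
     (\<lambda>c. if c \<in> charts_at A (\<gamma> t) then vector_derivative (snd c \<circ> \<gamma>) (at t within I) else 0)"

definition unit_speed_curve ::
    "'a topology \<Rightarrow> ('a, 'e::euclidean_space) chart set \<Rightarrow> ('a, 'e) metric \<Rightarrow> real set \<Rightarrow>
     (real \<Rightarrow> 'a) \<Rightarrow> bool" where
  "unit_speed_curve X A g I \<gamma> \<longleftrightarrow>
     smooth_curve X A I \<gamma> \<and>
     (\<forall>t\<in>I. g (\<gamma> t) (velocity A I \<gamma> t) (velocity A I \<gamma> t) = 1)"

text \<open>
  The coordinates of the covariant derivative of \<open>U = \<Sum>j. u\<^sub>j E\<^sub>j\<close> along \<open>\<gamma>\<close>, where
  \<open>\<gamma>' = \<Sum>i. T\<^sub>i E\<^sub>i\<close>, namely of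
  \<open>\<Sum>j. u\<^sub>j' E\<^sub>j + \<Sum>i j. T\<^sub>i u\<^sub>j D\<^bsub>E\<^sub>i\<^esub> E\<^sub>j\<close>.
  When \<open>D\<close> is the Levi-Civita connection of a bi-invariant metric this is \<open>U' + [T, U] / 2\<close>.
\<close>

definition cov_deriv ::
    "('a, real^3) metric \<Rightarrow> ('a, real^3) connection \<Rightarrow> (3 \<Rightarrow> ('a, real^3) vfield) \<Rightarrow>
     real set \<Rightarrow> (real \<Rightarrow> 'a) \<Rightarrow> (real \<Rightarrow> real^3) \<Rightarrow> (real \<Rightarrow> real^3) \<Rightarrow> real \<Rightarrow> real^3" where
  "cov_deriv g D E I \<gamma> T U t =
     vector_derivative U (at t within I) +
     (\<chi> k. \<Sum>i\<in>UNIV. \<Sum>j\<in>UNIV.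
        T t $ i * U t $ j * g (\<gamma> t) (D (E i) (E j) (\<gamma> t)) (E k (\<gamma> t)))"

definition frenet_apparatus ::
    "'a topology \<Rightarrow> ('a, real^3) chart set \<Rightarrow> ('a, real^3) metric \<Rightarrow> ('a, real^3) connection \<Rightarrow>
     (3 \<Rightarrow> ('a, real^3) vfield) \<Rightarrow> real set \<Rightarrow> (real \<Rightarrow> 'a) \<Rightarrow>
     (real \<Rightarrow> real^3) \<Rightarrow> (real \<Rightarrow> real^3) \<Rightarrow> (real \<Rightarrow> real^3) \<Rightarrow>
     (real \<Rightarrow> real) \<Rightarrow> (real \<Rightarrow> real) \<Rightarrow> bool" where
  "frenet_apparatus X A g D E I \<gamma> T N B \<kappa> \<tau> \<longleftrightarrow>
     unit_speed_curve X A g I \<gamma> \<and>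
     smooth_on I T \<and> smooth_on I N \<and> smooth_on I B \<and>
     (\<forall>t\<in>I.
        velocity A I \<gamma> t = frame_vec E (\<gamma> t) (T t) \<and>
        \<kappa> t = norm (cov_deriv g D E I \<gamma> T T t) \<and> \<kappa> t > 0 \<and>
        norm (T t) = 1 \<and> norm (N t) = 1 \<and> norm (B t) = 1 \<and>
        T t \<bullet> N t = 0 \<and> T t \<bullet> B t = 0 \<and> N t \<bullet> B t = 0 \<and>
        det (vector [T t, N t, B t] :: real^3^3) > 0 \<and>
        cov_deriv g D E I \<gamma> T T t = \<kappa> t *\<^sub>R N t \<and>
        cov_deriv g D E I \<gamma> T N t = - \<kappa> t *\<^sub>R T t + \<tau> t *\<^sub>R B t \<and>
        cov_deriv g D E I \<gamma> T B t = - \<tau> t *\<^sub>R N t)"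

definition frenet_curve ::
    "'a topology \<Rightarrow> ('a, real^3) chart set \<Rightarrow> ('a, real^3) metric \<Rightarrow> ('a, real^3) connection \<Rightarrow>
     (3 \<Rightarrow> ('a, real^3) vfield) \<Rightarrow> real set \<Rightarrow> (real \<Rightarrow> 'a) \<Rightarrow>
     (real \<Rightarrow> real^3) \<Rightarrow> (real \<Rightarrow> real^3) \<Rightarrow> (real \<Rightarrow> real^3) \<Rightarrow>
     (real \<Rightarrow> real) \<Rightarrow> (real \<Rightarrow> real) \<Rightarrow> bool" where
  "frenet_curve X A g D E I \<gamma> T N B \<kappa> \<tau> \<longleftrightarrow>
     frenet_apparatus X A g D E I \<gamma> T N B \<kappa> \<tau> \<and> (\<forall>t\<in>I. \<tau> t \<noteq> 0)"

definition lie_torsion ::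
    "('a, 'b) monoid_scheme \<Rightarrow> ('a, real^3) chart set \<Rightarrow> ('a, real^3) metric \<Rightarrow>
     (3 \<Rightarrow> ('a, real^3) vfield) \<Rightarrow>
     (real \<Rightarrow> real^3) \<Rightarrow> (real \<Rightarrow> real^3) \<Rightarrow> (real \<Rightarrow> real^3) \<Rightarrow> real \<Rightarrow> real" where
  "lie_torsion G A g E T N B t = 1/2 * (alg_bracket G A g E (T t) (N t) \<bullet> B t)"

text \<open>
  \<open>\<gamma>\<^sub>s\<close>, with the given apparatus, is the conjugate mate of a curve with binormal \<open>B\<close>;
  vector fields along the two curves are compared as maps into the Lie algebra.
\<close>

definition conjugate_mate ::
    "'a topology \<Rightarrow> ('a, real^3) chart set \<Rightarrow> ('a, real^3) metric \<Rightarrow> ('a, real^3) connection \<Rightarrow>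
     (3 \<Rightarrow> ('a, real^3) vfield) \<Rightarrow> real set \<Rightarrow> (real \<Rightarrow> real^3) \<Rightarrow> (real \<Rightarrow> 'a) \<Rightarrow>
     (real \<Rightarrow> real^3) \<Rightarrow> (real \<Rightarrow> real^3) \<Rightarrow> (real \<Rightarrow> real^3) \<Rightarrow>
     (real \<Rightarrow> real) \<Rightarrow> (real \<Rightarrow> real) \<Rightarrow> bool" where
  "conjugate_mate X A g D E I B \<gamma>\<^sub>s T\<^sub>s N\<^sub>s B\<^sub>s \<kappa>\<^sub>s \<tau>\<^sub>s \<longleftrightarrow>
     frenet_apparatus X A g D E I \<gamma>\<^sub>s T\<^sub>s N\<^sub>s B\<^sub>s \<kappa>\<^sub>s \<tau>\<^sub>s \<and> (\<forall>t\<in>I. T\<^sub>s t = B t)"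

end

theory Submission
  imports Defs
begin

text \<open>
  In dimension three the bracket of a Lie algebra with a bi-invariant metric is a multiple of
  the cross product: there is a constant \<open>c\<close> with \<open>[u, v] / 2 = c (u \<times> v)\<close>
  (\<open>alg_bracket_cross3\<close>).  Consequently \<open>\<nabla>\<^sub>T U = U' + c (T \<times> U)\<close> along every
  curve (\<open>cov_deriv_cross3\<close>), every Frenet frame has Lie group torsion \<open>c\<close>, and the Frenet
  equations become
  \<open>T' = \<kappa> N\<close>, \<open>N' = - \<kappa> T + (\<tau> - c) B\<close>, \<open>B' = - (\<tau> - c) N\<close>
  (\<open>frenet_derivatives\<close>).  These are the equations of a Euclidean Frenet frame with curvature
  \<open>\<kappa>\<close> and torsion \<open>\<tau> - c\<close>; the position of the curve in the group has disappeared, which is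
  what makes it possible to compare frames along different curves.

  If now \<open>T\<^sub>s = B\<close>, then \<open>\<kappa>\<^sub>s N\<^sub>s = B' = - (\<tau> - c) N\<close> determines \<open>\<kappa>\<^sub>s\<close> and \<open>N\<^sub>s\<close>, the cross
  product \<open>B\<^sub>s = T\<^sub>s \<times> N\<^sub>s\<close> determines \<open>B\<^sub>s\<close>, and differentiating \<open>B\<^sub>s \<bullet> N = 0\<close> yields
  \<open>\<tau>\<^sub>s - c = \<kappa>\<close> (\<open>conjugate_mate_apparatus\<close>).  The converse is clear, because \<open>T\<^sub>s = B\<close> is
  one of the six equations.

  It remains to see why the bracket has this form and why \<open>D\<^bsub>E\<^sub>i\<^esub> E\<^sub>j = [E\<^sub>i, E\<^sub>j] / 2\<close>.  Both follow
  from two properties of the structure constants \<open>\<langle>[E\<^sub>i, E\<^sub>j], E\<^sub>k\<rangle>\<close>: they are the same at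
  every point, and they are totally skew.  Right translation by \<open>b\<close> maps \<open>E\<^sub>i(p)\<close> to
  \<open>\<Sum>\<^sub>j a\<^sub>i\<^sub>j(b) E\<^sub>j(p b)\<close>.  The coefficients do not depend on \<open>p\<close>, since left and right
  translations commute, and they form an orthogonal matrix, since the metric is bi-invariant.
  Both sides can be written in charts by means of the partial derivatives of the multiplication
  map.  Differentiating with respect to \<open>b\<close> at the identity in the direction \<open>E\<^sub>k\<close>, and
  interchanging the two partial derivatives, gives
  \<open>[E\<^sub>i, E\<^sub>k](p) = \<Sum>\<^sub>j (\<partial>\<^sub>k a\<^sub>i\<^sub>j) E\<^sub>j(p)\<close> (\<open>lie_bracket_frame\<close>).  The numbers \<open>\<partial>\<^sub>k a\<^sub>i\<^sub>j\<close>
  are independent of \<open>p\<close>, and skew in \<open>i\<close> and \<open>j\<close>, as the derivative of a family of orthogonal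
  matrices at the unit matrix is skew-symmetric.
\<close>

section \<open>Symmetry of second derivatives\<close>

text \<open>
  The mean value theorem is applied twice, first to \<open>s \<mapsto> f (x + s u + h v) - f (x + s u)\<close>
  and then to the derivative of \<open>f\<close> in the direction \<open>u\<close> along \<open>v\<close>.  The left-hand side is
  symmetric in \<open>u\<close> and \<open>v\<close>, so that exchanging them expresses the same number by the other mixed
  derivative.
\<close>

lemma second_difference_mvt:
  fixes f :: "'a::euclidean_space \<Rightarrow> real"
  assumes "h > 0"
    and W: "\<And>s t. \<lbrakk>0 \<le> s; s \<le> h; 0 \<le> t; t \<le> h\<rbrakk> \<Longrightarrow> x + s *\<^sub>R u + t *\<^sub>R v \<in> W"
    and f: "\<And>y. y \<in> W \<Longrightarrow> (f has_derivative f' y) (at y)"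
    and fu: "\<And>y. y \<in> W \<Longrightarrow> ((\<lambda>z. f' z u) has_derivative f'' y) (at y)"
  shows "\<exists>s t. 0 < s \<and> s < h \<and> 0 < t \<and> t < h \<and>
    f (x + h *\<^sub>R u + h *\<^sub>R v) - f (x + h *\<^sub>R u) - f (x + h *\<^sub>R v) + f x
      = h * h * f'' (x + s *\<^sub>R u + t *\<^sub>R v) v"
proof -
  have d: "((\<lambda>s. f (x + s *\<^sub>R u + r *\<^sub>R v)) has_real_derivative f' (x + s *\<^sub>R u + r *\<^sub>R v) u) (at s)"
    if "0 \<le> s" "s \<le> h" "0 \<le> r" "r \<le> h" for s r
  proof -
    have "((\<lambda>s. f (x + s *\<^sub>R u + r *\<^sub>R v)) has_derivative
        (\<lambda>z. f' (x + s *\<^sub>R u + r *\<^sub>R v) (z *\<^sub>R u))) (at s)"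
      by (rule has_derivative_compose[where g = f and f = "\<lambda>s. x + s *\<^sub>R u + r *\<^sub>R v", OF _ f[OF W[OF that]]])
        (auto intro!: derivative_eq_intros)
    moreover have "f' (x + s *\<^sub>R u + r *\<^sub>R v) (z *\<^sub>R u) = f' (x + s *\<^sub>R u + r *\<^sub>R v) u * z" for z
      using linear_cmul[OF has_derivative_linear[OF f[OF W[OF that]]]] by simp
    ultimately show ?thesis
      by (simp add: has_field_derivative_def fun_eq_iff)
  qed
  define k where "k s = f (x + s *\<^sub>R u + h *\<^sub>R v) - f (x + s *\<^sub>R u + 0 *\<^sub>R v)" for s
  have "\<exists>s. s > 0 \<and> s < h \<and> k h - k 0 =
      (h - 0) * (f' (x + s *\<^sub>R u + h *\<^sub>R v) u - f' (x + s *\<^sub>R u + 0 *\<^sub>R v) u)"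
    unfolding k_def using \<open>h > 0\<close>
    by (intro MVT2[OF \<open>h > 0\<close>] DERIV_diff d) auto
  then obtain s where s: "0 < s" "s < h"
    and ks: "k h - k 0 = h * (f' (x + s *\<^sub>R u + h *\<^sub>R v) u - f' (x + s *\<^sub>R u + 0 *\<^sub>R v) u)"
    by auto
  have d2: "((\<lambda>t. f' (x + s *\<^sub>R u + t *\<^sub>R v) u) has_real_derivative
        f'' (x + s *\<^sub>R u + t *\<^sub>R v) v) (at t)" if "0 \<le> t" "t \<le> h" for t
  proof -
    have y: "x + s *\<^sub>R u + t *\<^sub>R v \<in> W" using W s that by auto
    have "((\<lambda>t. f' (x + s *\<^sub>R u + t *\<^sub>R v) u) has_derivative
        (\<lambda>z. f'' (x + s *\<^sub>R u + t *\<^sub>R v) (z *\<^sub>R v))) (at t)"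
      by (rule has_derivative_compose[where g = "\<lambda>z. f' z u" and f = "\<lambda>t. x + s *\<^sub>R u + t *\<^sub>R v", OF _ fu[OF y]])
        (auto intro!: derivative_eq_intros)
    moreover have "f'' (x + s *\<^sub>R u + t *\<^sub>R v) (z *\<^sub>R v) = f'' (x + s *\<^sub>R u + t *\<^sub>R v) v * z" for z
      using linear_cmul[OF has_derivative_linear[OF fu[OF y]]] by simp
    ultimately show ?thesis
      by (simp add: has_field_derivative_def fun_eq_iff)
  qed
  have "\<exists>t. t > 0 \<and> t < h \<and> f' (x + s *\<^sub>R u + h *\<^sub>R v) u - f' (x + s *\<^sub>R u + 0 *\<^sub>R v) u
      = (h - 0) * f'' (x + s *\<^sub>R u + t *\<^sub>R v) v"
    by (intro MVT2[OF \<open>h > 0\<close>] d2) auto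
  then obtain t where "0 < t" "t < h"
    "f' (x + s *\<^sub>R u + h *\<^sub>R v) u - f' (x + s *\<^sub>R u + 0 *\<^sub>R v) u = h * f'' (x + s *\<^sub>R u + t *\<^sub>R v) v"
    by auto
  with s ks show ?thesis
    by (intro exI[of _ s] exI[of _ t]) (simp add: k_def algebra_simps)
qed

text \<open>
  If the mixed derivatives differed at \<open>x\<close>, then by continuity they would be separated on a
  small ball; but by \<open>second_difference_mvt\<close> every small parallelogram at \<open>x\<close> contains two
  points at which they agree.
\<close>

lemma symmetric_second_derivative_real:
  fixes f :: "'a::euclidean_space \<Rightarrow> real"
  assumes "open W" "x \<in> W"
    and f: "\<And>y. y \<in> W \<Longrightarrow> (f has_derivative f' y) (at y)"
    and fu: "\<And>y. y \<in> W \<Longrightarrow> ((\<lambda>z. f' z u) has_derivative fu' y) (at y)"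
    and fv: "\<And>y. y \<in> W \<Longrightarrow> ((\<lambda>z. f' z v) has_derivative fv' y) (at y)"
    and cu: "isCont (\<lambda>y. fu' y v) x"
    and cv: "isCont (\<lambda>y. fv' y u) x"
  shows "fu' x v = fv' x u"
proof (rule ccontr)
  assume ne: "fu' x v \<noteq> fv' x u"
  define e where "e = \<bar>fu' x v - fv' x u\<bar> / 2"
  have "e > 0" using ne by (simp add: e_def)
  from cu \<open>e > 0\<close> obtain d1 where d1: "d1 > 0" "\<And>y. dist y x < d1 \<Longrightarrow> \<bar>fu' y v - fu' x v\<bar> < e"
    unfolding continuous_at_eps_delta dist_real_def by blast
  from cv \<open>e > 0\<close> obtain d2 where d2: "d2 > 0" "\<And>y. dist y x < d2 \<Longrightarrow> \<bar>fv' y u - fv' x u\<bar> < e"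
    unfolding continuous_at_eps_delta dist_real_def by blast
  obtain d3 where d3: "d3 > 0" "ball x d3 \<subseteq> W"
    using \<open>open W\<close> \<open>x \<in> W\<close> open_contains_ball by blast
  define d where "d = min d1 (min d2 d3)"
  have "d > 0" using d1 d2 d3 by (simp add: d_def)
  \<comment> \<open>Small enough that the parallelogram spanned by \<open>h u\<close> and \<open>h v\<close> at \<open>x\<close> lies in the ball of radius \<open>d\<close>.\<close>
  define h where "h = d / (2 * (norm u + norm v + 1))"
  have pos: "norm u + norm v + 1 > 0" by (simp add: add_nonneg_pos)
  have "h > 0" using \<open>d > 0\<close> pos by (simp add: h_def)
  have near: "dist (x + s *\<^sub>R u + t *\<^sub>R v) x < d" if "0 \<le> s" "s \<le> h" "0 \<le> t" "t \<le> h" for s t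
  proof -
    have "dist (x + s *\<^sub>R u + t *\<^sub>R v) x = norm (s *\<^sub>R u + t *\<^sub>R v)"
      by (simp add: dist_norm)
    also have "\<dots> \<le> s * norm u + t * norm v"
      using that by (metis (no_types, lifting) norm_triangle_ineq norm_scaleR abs_of_nonneg)
    also have "\<dots> \<le> h * norm u + h * norm v"
      using that by (intro add_mono mult_right_mono) auto
    also have "\<dots> \<le> h * (norm u + norm v + 1)"
      using \<open>h > 0\<close> by (simp add: algebra_simps)
    also have "\<dots> = d / 2" 
    proof -
      have "d / (2 * P) * P = d / 2" if "P > 0" for P :: real using that by simp
      from this[OF pos] show ?thesis by (simp only: h_def)
    qed
    also have "\<dots> < d" using \<open>d > 0\<close> by simp
    finally show ?thesis .
  qed
  have inW: "y \<in> W" if "dist y x < d" for y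
    using that d3 by (auto simp: d_def dist_commute)
  obtain s t where st: "0 < s" "s < h" "0 < t" "t < h"
    "f (x + h *\<^sub>R u + h *\<^sub>R v) - f (x + h *\<^sub>R u) - f (x + h *\<^sub>R v) + f x
      = h * h * fu' (x + s *\<^sub>R u + t *\<^sub>R v) v"
    using second_difference_mvt[OF \<open>h > 0\<close> inW[OF near] f fu] by auto
  have near': "dist (x + s *\<^sub>R v + t *\<^sub>R u) x < d" if "0 \<le> s" "s \<le> h" "0 \<le> t" "t \<le> h" for s t
    using near[of t s] that by (simp add: algebra_simps)
  obtain s' t' where st': "0 < s'" "s' < h" "0 < t'" "t' < h"
    "f (x + h *\<^sub>R v + h *\<^sub>R u) - f (x + h *\<^sub>R v) - f (x + h *\<^sub>R u) + f x
      = h * h * fv' (x + s' *\<^sub>R v + t' *\<^sub>R u) u"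
    using second_difference_mvt[OF \<open>h > 0\<close> inW[OF near'] f fv] by auto
  have "h * h * fu' (x + s *\<^sub>R u + t *\<^sub>R v) v = h * h * fv' (x + s' *\<^sub>R v + t' *\<^sub>R u) u"
    using st(5) st'(5) by (simp add: algebra_simps)
  then have "fu' (x + s *\<^sub>R u + t *\<^sub>R v) v = fv' (x + s' *\<^sub>R v + t' *\<^sub>R u) u"
    using \<open>h > 0\<close> by simp
  moreover have "\<bar>fu' (x + s *\<^sub>R u + t *\<^sub>R v) v - fu' x v\<bar> < e"
    using near[of s t] st by (intro d1) (auto simp: d_def)
  moreover have "\<bar>fv' (x + s' *\<^sub>R v + t' *\<^sub>R u) u - fv' x u\<bar> < e"
    using near'[of s' t'] st' by (intro d2) (auto simp: d_def)
  ultimately show False unfolding e_def by (auto simp: abs_if split: if_splits)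
qed

lemma Ck_on_has_derivative:
  assumes "Ck_on (Suc k) S f" "open S" "x \<in> S"
  shows "(f has_derivative frechet_derivative f (at x)) (at x)"
proof -
  have "f differentiable (at x within S)"
    using assms by (simp add: differentiable_on_def)
  then show ?thesis
    unfolding at_within_open[OF assms(3,2)] by (rule iffD1[OF frechet_derivative_works])
qed

text \<open>
  On open sets the derivatives within the set that occur in the definition of \<open>Ck_on\<close> are
  ordinary derivatives.
\<close>

lemma Ck_on_second_derivative:
  assumes "Ck_on (Suc (Suc k)) S f" "open S" "x \<in> S"
  shows "((\<lambda>y. frechet_derivative f (at y) v) has_derivative
      frechet_derivative (\<lambda>y. frechet_derivative f (at y within S) v) (at x)) (at x)"
proof -
  have "Ck_on (Suc k) S (\<lambda>y. frechet_derivative f (at y within S) v)"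
    using assms(1) by simp
  from Ck_on_has_derivative[OF this assms(2,3)] show ?thesis
    by (rule has_derivative_transform_within_open[OF _ assms(2,3)])
      (simp add: at_within_open[OF _ assms(2)])
qed

lemma symmetric_second_derivative:
  fixes f :: "'a::euclidean_space \<Rightarrow> 'b::euclidean_space"
  assumes C: "Ck_on (Suc (Suc k)) W f" and W: "open W" "x \<in> W"
  shows "frechet_derivative (\<lambda>y. frechet_derivative f (at y) u) (at x) v
       = frechet_derivative (\<lambda>y. frechet_derivative f (at y) v) (at x) u"
proof (rule euclidean_eqI)
  fix b :: 'b
  let ?D = "\<lambda>u y. frechet_derivative (\<lambda>z. frechet_derivative f (at z within W) u) (at y)"
  note D2 = Ck_on_second_derivative[OF C W(1)]
  have D: "frechet_derivative (\<lambda>y. frechet_derivative f (at y) u) (at x) = ?D u x" for u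
    using frechet_derivative_at[OF D2[OF W(2)]] by simp
  have cont: "isCont (\<lambda>y. ?D u y v) x" for u v
  proof -
    have "continuous_on W (\<lambda>y. frechet_derivative
        (\<lambda>z. frechet_derivative f (at z within W) u) (at y within W) v)"
      \<comment> \<open>Continuity is part of the definition for \<open>k = 0\<close> and follows from differentiability for larger \<open>k\<close>.\<close>
      using C by (cases k) (auto intro: differentiable_imp_continuous_on)
    then have "continuous_on W (\<lambda>y. ?D u y v)"
      by (rule continuous_on_eq) (simp add: at_within_open[OF _ W(1)])
    then show ?thesis using W continuous_on_eq_continuous_at by blast
  qed
  have "?D u x v \<bullet> b = ?D v x u \<bullet> b"
    by (rule symmetric_second_derivative_real[OF W,
          where f = "\<lambda>y. f y \<bullet> b" and f' = "\<lambda>y h. frechet_derivative f (at y) h \<bullet> b"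
            and fu' = "\<lambda>y h. ?D u y h \<bullet> b" and fv' = "\<lambda>y h. ?D v y h \<bullet> b"])
      (auto intro!: has_derivative_inner_left Ck_on_has_derivative[OF C W(1)] D2 continuous_intros cont)
  then show "frechet_derivative (\<lambda>y. frechet_derivative f (at y) u) (at x) v \<bullet> b
       = frechet_derivative (\<lambda>y. frechet_derivative f (at y) v) (at x) u \<bullet> b"
    by (simp add: D)
qed

section \<open>Differentials of maps of a manifold\<close>

locale smooth_mfd =
  fixes X :: "'a topology" and A :: "('a, 'e::euclidean_space) chart set"
  assumes mfd: "smooth_manifold X A"
begin

lemma chart:
  assumes "c \<in> A"
  shows open_chart_domain: "openin X (fst c)"
    and open_chart_image: "open (snd c ` fst c)"
    and chart_homeo: "homeomorphic_map (subtopology X (fst c)) (top_of_set (snd c ` fst c)) (snd c)"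
  using mfd assms by (auto simp: smooth_manifold_def)

lemma chart_domain_subset: "c \<in> A \<Longrightarrow> fst c \<subseteq> topspace X"
  using open_chart_domain openin_subset by blast

lemma chart_inj: "c \<in> A \<Longrightarrow> inj_on (snd c) (fst c)"
  using homeomorphic_imp_injective_map[OF chart_homeo, of c] chart_domain_subset
  by (simp add: topspace_subtopology Int_absorb1)

lemma chart_inv_chart: "c \<in> A \<Longrightarrow> p \<in> fst c \<Longrightarrow> chart_inv c (snd c p) = p"
  by (simp add: chart_inv_def chart_inj inv_into_f_f)

lemma charts_atD: "c \<in> charts_at A p \<Longrightarrow> c \<in> A \<and> p \<in> fst c"
  by (simp add: charts_at_def)

lemma charts_at_topspace: "c \<in> charts_at A p \<Longrightarrow> p \<in> topspace X"
  using chart_domain_subset[of c] by (auto simp: charts_at_def)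

lemma ex_chart: "p \<in> topspace X \<Longrightarrow> \<exists>c. c \<in> charts_at A p"
  using mfd unfolding smooth_manifold_def charts_at_def by blast

lemma some_chart: "p \<in> topspace X \<Longrightarrow> (SOME c. c \<in> charts_at A p) \<in> charts_at A p"
  by (rule someI_ex) (rule ex_chart)

lemma open_chart_preimage:
  assumes c: "c \<in> A" and U: "openin X U"
  shows "open (snd c ` (fst c \<inter> U))"
proof -
  have "openin (subtopology X (fst c)) (fst c \<inter> U)"
    using U by (metis Int_commute openin_subtopology_Int)
  then have "openin (top_of_set (snd c ` fst c)) (snd c ` (fst c \<inter> U))"
    using homeomorphic_imp_open_map[OF chart_homeo[OF c]] by (simp add: open_map_def)
  then show ?thesis
    using open_chart_image[OF c] openin_open_trans by blast
qed

lemma continuous_map_chart_inv: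
  assumes c: "c \<in> A"
  shows "continuous_map (top_of_set (snd c ` fst c)) X (chart_inv c)"
proof -
  obtain h where h: "homeomorphic_maps (subtopology X (fst c)) (top_of_set (snd c ` fst c)) (snd c) h"
    using chart_homeo[OF c] homeomorphic_map_maps by blast
  have hc: "continuous_map (top_of_set (snd c ` fst c)) X h"
    using h unfolding homeomorphic_maps_def continuous_map_in_subtopology by blast
  moreover have "chart_inv c y = h y" if y: "y \<in> snd c ` fst c" for y
  proof -
    obtain p where p: "p \<in> fst c" "y = snd c p" using y by auto
    have "h (snd c p) = p"
      using h p chart_domain_subset[OF c] by (auto simp: homeomorphic_maps_def)
    with p show ?thesis by (simp add: chart_inv_chart[OF c])
  qed
  ultimately show ?thesis
    by (auto intro: continuous_map_eq)
qed

lemma tangent_spaceI: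
  assumes "\<And>c d. \<lbrakk>c \<in> charts_at A p; d \<in> charts_at A p\<rbrakk> \<Longrightarrow>
      frechet_derivative (local_rep id c d) (at (snd c p)) (v c) = v d"
    and "\<And>c. c \<notin> charts_at A p \<Longrightarrow> v c = 0"
  shows "v \<in> tangent_space A p"
  unfolding tangent_space_def
  by (intro CollectI conjI ballI allI impI assms(1)[symmetric] assms(2))

lemma tangent_space_transition:
  assumes "v \<in> tangent_space A p" "c \<in> charts_at A p" "d \<in> charts_at A p"
  shows "frechet_derivative (local_rep id c d) (at (snd c p)) (v c) = v d"
  using assms(1) unfolding tangent_space_def mem_Collect_eq
  by (elim conjE) (rule sym, rule bspec[OF _ assms(3)], erule bspec[OF _ assms(2)])

lemma tangent_space_outside: "v \<in> tangent_space A p \<Longrightarrow> c \<notin> charts_at A p \<Longrightarrow> v c = 0"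
  unfolding tangent_space_def by blast

text \<open>
  Continuity ensures that \<open>f\<close> maps a neighbourhood of \<open>p\<close> into the domain of any given chart
  around \<open>f p\<close>; otherwise the local representation of \<open>f\<close> near \<open>p\<close> would
  involve values of charts outside their domains.
\<close>

definition differentiable_at_point :: "('a \<Rightarrow> 'a) \<Rightarrow> 'a \<Rightarrow> bool" where
  "differentiable_at_point f p \<longleftrightarrow> p \<in> topspace X \<and> continuous_map X X f \<and>
     (\<forall>c\<in>charts_at A p. \<forall>d\<in>charts_at A (f p). local_rep f c d differentiable (at (snd c p)))"

lemma differentiable_at_point_id:
  assumes "p \<in> topspace X"
  shows "differentiable_at_point id p"
  unfolding differentiable_at_point_def
proof (intro conjI ballI assms)
  fix c d assume "c \<in> charts_at A p" "d \<in> charts_at A (id p)"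
  then have c: "c \<in> A" "p \<in> fst c" and d: "d \<in> A" "p \<in> fst d" by (auto simp: charts_at_def)
  have "smooth_on (snd c ` (fst c \<inter> fst d)) (local_rep id c d)"
    using mfd c d by (simp add: smooth_manifold_def)
  then have "Ck_on (Suc 0) (snd c ` (fst c \<inter> fst d)) (local_rep id c d)"
    unfolding smooth_on_def by blast
  from Ck_on_has_derivative[OF this open_chart_preimage[OF c(1) open_chart_domain[OF d(1)]]]
  show "local_rep id c d differentiable at (snd c p)"
    using c d by (auto simp: differentiable_def)
qed auto

text \<open>
  The chain rule in charts.  Since tangent vectors are transformed by the local
  representations of the identity, the cases where \<open>f\<close> or \<open>h\<close> is the identity express that the
  differential does not depend on charts and takes tangent vectors to tangent vectors.
\<close>

lemma local_rep_compose:
  assumes f: "differentiable_at_point f p" and h: "differentiable_at_point h (f p)"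
    and c: "c \<in> charts_at A p" and d: "d \<in> charts_at A (f p)" and e: "e \<in> charts_at A (h (f p))"
  shows "(local_rep (h \<circ> f) c e has_derivative
      frechet_derivative (local_rep h d e) (at (snd d (f p))) \<circ>
      frechet_derivative (local_rep f c d) (at (snd c p))) (at (snd c p))"
proof -
  let ?U = "fst c \<inter> {q \<in> topspace X. f q \<in> fst d}"
  note c' = charts_atD[OF c] and d' = charts_atD[OF d]
  have "openin X {q \<in> topspace X. f q \<in> fst d}"
    using f d' by (auto simp: differentiable_at_point_def intro: openin_continuous_map_preimage open_chart_domain)
  then have op: "open (snd c ` ?U)"
    using c' open_chart_preimage by blast
  have x: "snd c p \<in> snd c ` ?U"
    using c' d' f by (auto simp: differentiable_at_point_def)
  have fp: "local_rep f c d (snd c p) = snd d (f p)"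
    using c' by (simp add: local_rep_def chart_inv_chart)
  have "(local_rep h d e \<circ> local_rep f c d has_derivative
      frechet_derivative (local_rep h d e) (at (snd d (f p))) \<circ>
      frechet_derivative (local_rep f c d) (at (snd c p))) (at (snd c p))"
    using f h c d e
    by (intro diff_chain_at) (auto simp: differentiable_at_point_def fp frechet_derivative_works[symmetric])
  then show ?thesis
  proof (rule has_derivative_transform_within_open[OF _ op x])
    fix y assume "y \<in> snd c ` ?U"
    then show "(local_rep h d e \<circ> local_rep f c d) y = local_rep (h \<circ> f) c e y"
      using c' d' by (auto simp: local_rep_def chart_inv_chart)
  qed
qed

lemma frechet_derivative_local_rep_compose:
  assumes "differentiable_at_point f p" and "differentiable_at_point h (f p)"
    and "c \<in> charts_at A p" and "d \<in> charts_at A (f p)" and "e \<in> charts_at A (h (f p))"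
  shows "frechet_derivative (local_rep (h \<circ> f) c e) (at (snd c p)) v =
      frechet_derivative (local_rep h d e) (at (snd d (f p)))
        (frechet_derivative (local_rep f c d) (at (snd c p)) v)"
  using frechet_derivative_at[OF local_rep_compose[OF assms]] by (metis comp_apply)

lemma differentiable_at_point_compose:
  assumes f: "differentiable_at_point f p" and h: "differentiable_at_point h (f p)"
  shows "differentiable_at_point (h \<circ> f) p"
proof -
  obtain d where d: "d \<in> charts_at A (f p)"
    using h ex_chart[of "f p"] unfolding differentiable_at_point_def by blast
  have "local_rep (h \<circ> f) c e differentiable (at (snd c p))"
    if "c \<in> charts_at A p" "e \<in> charts_at A ((h \<circ> f) p)" for c e
    using local_rep_compose[OF f h that(1) d, of e] that(2) unfolding differentiable_def by auto
  then show ?thesis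
    using f h by (auto simp: differentiable_at_point_def intro: continuous_map_compose)
qed

lemma differential_eq:
  assumes f: "differentiable_at_point f p" and v: "v \<in> tangent_space A p"
    and c: "c \<in> charts_at A p" and d: "d \<in> charts_at A (f p)"
  shows "differential A A f p v d = frechet_derivative (local_rep f c d) (at (snd c p)) (v c)"
proof -
  \<comment> \<open>The chart chosen in the definition of the differential.\<close>
  define c' where "c' = (SOME c. c \<in> charts_at A p)"
  have p: "p \<in> topspace X" using f by (simp add: differentiable_at_point_def)
  have c': "c' \<in> charts_at A p" unfolding c'_def by (rule some_chart[OF p])
  have "differential A A f p v d = frechet_derivative (local_rep f c' d) (at (snd c' p)) (v c')"
    using d by (simp add: differential_def c'_def Let_def)
  also have "\<dots> = frechet_derivative (local_rep f c d) (at (snd c p))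
      (frechet_derivative (local_rep id c' c) (at (snd c' p)) (v c'))"
    using frechet_derivative_local_rep_compose[OF differentiable_at_point_id[OF p], of f c' c d] f c' c d
    by simp
  also have "frechet_derivative (local_rep id c' c) (at (snd c' p)) (v c') = v c"
    by (rule tangent_space_transition[OF v c' c])
  finally show ?thesis .
qed

lemma differential_in_tangent_space:
  assumes f: "differentiable_at_point f p" and v: "v \<in> tangent_space A p"
  shows "differential A A f p v \<in> tangent_space A (f p)"
proof -
  have p: "p \<in> topspace X" and fp: "f p \<in> topspace X"
    using f by (auto simp: differentiable_at_point_def continuous_map_def)
  obtain c where c: "c \<in> charts_at A p" using ex_chart[OF p] by blast
  have "differential A A f p v d' =
      frechet_derivative (local_rep id d d') (at (snd d (f p))) (differential A A f p v d)"
    if d: "d \<in> charts_at A (f p)" "d' \<in> charts_at A (f p)" for d d'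
    using frechet_derivative_local_rep_compose[OF f differentiable_at_point_id[OF fp] c d(1), of d'] d
    by (simp add: differential_eq[OF f v c])
  from this[symmetric] show ?thesis
    by (rule tangent_spaceI) (simp_all add: differential_def)
qed

lemma differential_compose:
  assumes f: "differentiable_at_point f p" and h: "differentiable_at_point h (f p)"
    and v: "v \<in> tangent_space A p"
  shows "differential A A (h \<circ> f) p v = differential A A h (f p) (differential A A f p v)"
proof
  fix e
  show "differential A A (h \<circ> f) p v e = differential A A h (f p) (differential A A f p v) e"
  proof (cases "e \<in> charts_at A (h (f p))")
    case True
    obtain c d where c: "c \<in> charts_at A p" and d: "d \<in> charts_at A (f p)"
      using f h ex_chart unfolding differentiable_at_point_def by blast
    show ?thesis
      using True frechet_derivative_local_rep_compose[OF f h c d, of e] d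
      by (simp add: differential_eq[OF differentiable_at_point_compose[OF f h] v c]
          differential_eq[OF f v c]
          differential_eq[OF h differential_in_tangent_space[OF f v] d])
  qed (simp add: differential_def)
qed

text \<open>
  Functions on the carrier type are unconstrained outside the manifold, so maps such as
  \<open>q \<mapsto> (p q) b\<close> and \<open>q \<mapsto> p (q b)\<close> are equal on the manifold only.
\<close>

lemma differential_cong:
  assumes f: "differentiable_at_point f p" and eq: "\<And>q. q \<in> topspace X \<Longrightarrow> f q = h q"
  shows "differential A A f p v = differential A A h p v"
proof
  fix d
  define c where "c = (SOME c. c \<in> charts_at A p)"
  have p: "p \<in> topspace X" using f by (simp add: differentiable_at_point_def)
  have c: "c \<in> charts_at A p" unfolding c_def by (rule some_chart[OF p])
  show "differential A A f p v d = differential A A h p v d"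
  proof (cases "d \<in> charts_at A (f p)")
    case True
    have "frechet_derivative (local_rep f c d) (at (snd c p)) =
        frechet_derivative (local_rep h c d) (at (snd c p))"
    proof (rule frechet_derivative_transform_within_open)
      show "local_rep f c d differentiable at (snd c p)"
        using f c True by (simp add: differentiable_at_point_def)
      show "open (snd c ` fst c)" "snd c p \<in> snd c ` fst c"
        using charts_atD[OF c] open_chart_image by auto
      fix x assume "x \<in> snd c ` fst c"
      then show "local_rep f c d x = local_rep h c d x"
        using charts_atD[OF c] chart_domain_subset[of c] eq
        by (auto simp: local_rep_def chart_inv_chart)
    qed
    then show ?thesis using True eq[OF p] by (simp add: differential_def c_def[symmetric] Let_def)
  qed (simp add: differential_def eq[OF p])
qed

lemma differential_linear:
  assumes f: "differentiable_at_point f p" and v: "\<And>i. i \<in> S \<Longrightarrow> v i \<in> tangent_space A p" and "finite S"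
  shows "differential A A f p (\<lambda>c. \<Sum>i\<in>S. a i *\<^sub>R v i c) = (\<lambda>d. \<Sum>i\<in>S. a i *\<^sub>R differential A A f p (v i) d)"
proof
  fix d
  define c where "c = (SOME c. c \<in> charts_at A p)"
  have c: "c \<in> charts_at A p" using f some_chart by (auto simp: c_def differentiable_at_point_def)
  show "differential A A f p (\<lambda>c. \<Sum>i\<in>S. a i *\<^sub>R v i c) d = (\<Sum>i\<in>S. a i *\<^sub>R differential A A f p (v i) d)"
  proof (cases "d \<in> charts_at A (f p)")
    case True
    have "linear (frechet_derivative (local_rep f c d) (at (snd c p)))"
      using f c True by (intro linear_frechet_derivative) (auto simp: differentiable_at_point_def)
    then show ?thesis using True
      by (simp add: differential_def c_def[symmetric] Let_def linear_sum linear_cmul)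
  qed (simp add: differential_def)
qed

lemma tangent_space_sum:
  assumes p: "p \<in> topspace X" and v: "\<And>i. i \<in> S \<Longrightarrow> v i \<in> tangent_space A p"
  shows "(\<lambda>c. \<Sum>i\<in>S. a i *\<^sub>R v i c) \<in> tangent_space A p"
proof -
  have lin: "linear (frechet_derivative (local_rep id c d) (at (snd c p)))"
    if "c \<in> charts_at A p" "d \<in> charts_at A p" for c d
    using differentiable_at_point_id[OF p] that
    by (intro linear_frechet_derivative) (auto simp: differentiable_at_point_def)
  have "(\<Sum>i\<in>S. a i *\<^sub>R v i d) =
      frechet_derivative (local_rep id c d) (at (snd c p)) (\<Sum>i\<in>S. a i *\<^sub>R v i c)"
    if "c \<in> charts_at A p" "d \<in> charts_at A p" for c d
    unfolding linear_sum[OF lin[OF that]] linear_cmul[OF lin[OF that]]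
    using v that by (intro sum.cong refl) (simp add: tangent_space_transition)
  from this[symmetric] show ?thesis
    by (rule tangent_spaceI) (simp_all add: tangent_space_outside[OF v])
qed

lemma tangent_vector_eqI:
  assumes v: "v \<in> tangent_space A p" and w: "w \<in> tangent_space A p"
    and c: "c \<in> charts_at A p" and eq: "v c = w c"
  shows "v = w"
proof
  fix d
  show "v d = w d"
  proof (cases "d \<in> charts_at A p")
    case True
    then show ?thesis
      using tangent_space_transition[OF v c] tangent_space_transition[OF w c] eq by metis
  qed (use v w in \<open>simp add: tangent_space_outside\<close>)
qed

end

section \<open>The multiplication of a Lie group in charts\<close>

locale lie_grp = 
  fixes G :: "('a, 'b) monoid_scheme" (structure)
    and X :: "'a topology" and A :: "('a, 'e::euclidean_space) chart set"
  assumes lie: "lie_group G X A"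
begin

sublocale smooth_mfd X A
  using lie by unfold_locales (simp add: lie_group_def)

sublocale group G
  using lie by (simp add: lie_group_def)

lemma topspace_X: "topspace X = carrier G"
  using lie by (simp add: lie_group_def)

text \<open>
  The multiplication map in the product chart of \<open>c\<close> and \<open>d\<close>, with values in \<open>c'\<close>.  Its
  derivatives in directions \<open>(v, 0)\<close> and \<open>(0, v)\<close> are the differentials of right and left
  translations, so that the interplay of the two kinds of translations is contained in the
  derivatives of this one smooth map.
\<close>

definition mult_rep :: "('a, 'e) chart \<Rightarrow> ('a, 'e) chart \<Rightarrow> ('a, 'e) chart \<Rightarrow> 'e \<times> 'e \<Rightarrow> 'e" where
  "mult_rep c d c' =
     local_rep (\<lambda>(p, q). p \<otimes> q) (fst c \<times> fst d, map_prod (snd c) (snd d)) c'"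

definition mult_dom :: "('a, 'e) chart \<Rightarrow> ('a, 'e) chart \<Rightarrow> ('a, 'e) chart \<Rightarrow> ('e \<times> 'e) set" where
  "mult_dom c d c' = map_prod (snd c) (snd d) ` {z \<in> fst c \<times> fst d. (case z of (p, q) \<Rightarrow> p \<otimes> q) \<in> fst c'}"

lemma mult_rep_chart:
  assumes "c \<in> A" "d \<in> A" "p \<in> fst c" "q \<in> fst d"
  shows "mult_rep c d c' (snd c p, snd d q) = snd c' (p \<otimes> q)"
proof -
  have "inj_on (map_prod (snd c) (snd d)) (fst c \<times> fst d)"
    using assms chart_inj by (intro map_prod_inj_on)
  then have "chart_inv (fst c \<times> fst d, map_prod (snd c) (snd d)) (map_prod (snd c) (snd d) (p, q)) = (p, q)"
    using assms unfolding chart_inv_def by (simp add: inv_into_f_f del: map_prod_simp)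
  then show ?thesis
    by (simp add: mult_rep_def local_rep_def)
qed

lemma mult_dom_chart:
  assumes "p \<in> fst c" "q \<in> fst d" "p \<otimes> q \<in> fst c'"
  shows "(snd c p, snd d q) \<in> mult_dom c d c'"
  using assms unfolding mult_dom_def by (force intro!: image_eqI[of _ _ "(p, q)"])

lemma mult_domE:
  assumes "z \<in> mult_dom c d c'"
  obtains p q where "z = (snd c p, snd d q)" "p \<in> fst c" "q \<in> fst d" "p \<otimes> q \<in> fst c'"
  using assms unfolding mult_dom_def by auto

lemma charts_at_carrier: "c \<in> charts_at A p \<Longrightarrow> p \<in> carrier G"
  using charts_at_topspace topspace_X by simp

lemma ex_chart_carrier: "p \<in> carrier G \<Longrightarrow> \<exists>c. c \<in> charts_at A p"
  using ex_chart topspace_X by simp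

lemma continuous_map_mult: "continuous_map (prod_topology X X) X (\<lambda>(p, q). p \<otimes> q)"
  using lie by (simp add: lie_group_def smooth_map_def)

lemma Ck_on_mult_rep:
  assumes "c \<in> A" "d \<in> A" "c' \<in> A"
  shows "Ck_on k (mult_dom c d c') (mult_rep c d c')"
proof -
  have "(fst c \<times> fst d, map_prod (snd c) (snd d)) \<in> prod_atlas A A"
    unfolding prod_atlas_def using assms by blast
  then have "smooth_on (mult_dom c d c') (mult_rep c d c')"
    using lie assms(3) unfolding lie_group_def smooth_map_def mult_dom_def mult_rep_def by fastforce
  then show ?thesis by (simp add: smooth_on_def)
qed

text \<open>
  The inverses of the charts and the multiplication are continuous, so this is the preimage
  of an open chart domain under a continuous map on an open set.
\<close>

lemma open_mult_dom:
  assumes c: "c \<in> A" and d: "d \<in> A" and c': "c' \<in> A"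
  shows "open (mult_dom c d c')"
proof -
  let ?V = "snd c ` fst c \<times> snd d ` fst d"
  let ?f = "\<lambda>(x, y). chart_inv c x \<otimes> chart_inv d y"
  have "continuous_map (top_of_set ?V) X (chart_inv c \<circ> fst)"
    by (rule continuous_map_compose[OF _ continuous_map_chart_inv[OF c]])
      (auto simp: continuous_map_subtopology_eu intro: continuous_intros)
  moreover have "continuous_map (top_of_set ?V) X (chart_inv d \<circ> snd)"
    by (rule continuous_map_compose[OF _ continuous_map_chart_inv[OF d]])
      (auto simp: continuous_map_subtopology_eu intro: continuous_intros)
  ultimately have "continuous_map (top_of_set ?V) (prod_topology X X)
      (\<lambda>z. (chart_inv c (fst z), chart_inv d (snd z)))"
    by (simp add: continuous_map_pairwise o_def)
  from continuous_map_compose[OF this continuous_map_mult]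
  have "continuous_map (top_of_set ?V) X ?f"
    by (simp add: o_def case_prod_unfold)
  from openin_continuous_map_preimage[OF this open_chart_domain[OF c']]
  have "openin (top_of_set ?V) {z \<in> ?V. ?f z \<in> fst c'}" by simp
  then have "open {z \<in> ?V. ?f z \<in> fst c'}"
    using open_Times[OF open_chart_image[OF c] open_chart_image[OF d]] openin_open_trans by blast
  moreover have "{z \<in> ?V. ?f z \<in> fst c'} = mult_dom c d c'"
    using c d by (force simp: mult_dom_def chart_inv_chart)
  ultimately show ?thesis by simp
qed

lemma mult_rep_has_derivative:
  assumes c: "c \<in> charts_at A p" and d: "d \<in> charts_at A q" and c': "c' \<in> charts_at A (p \<otimes> q)"
  shows "(mult_rep c d c' has_derivative
      frechet_derivative (mult_rep c d c') (at (snd c p, snd d q))) (at (snd c p, snd d q))"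
  using charts_atD[OF c] charts_atD[OF d] charts_atD[OF c']
  by (intro Ck_on_has_derivative[OF Ck_on_mult_rep open_mult_dom] mult_dom_chart) auto

lemma left_translation_has_derivative:
  assumes c: "c \<in> charts_at A a" and d: "d \<in> charts_at A p" and c': "c' \<in> charts_at A (a \<otimes> p)"
  shows "(local_rep (\<lambda>q. a \<otimes> q) d c' has_derivative
      (\<lambda>v. frechet_derivative (mult_rep c d c') (at (snd c a, snd d p)) (0, v))) (at (snd d p))"
proof -
  note c_ = charts_atD[OF c] and d_ = charts_atD[OF d]
  have "((\<lambda>y. mult_rep c d c' (snd c a, y)) has_derivative
      (\<lambda>v. frechet_derivative (mult_rep c d c') (at (snd c a, snd d p)) (0, v))) (at (snd d p))"
    by (rule has_derivative_compose[where f = "\<lambda>y. (snd c a, y)" and g = "mult_rep c d c'",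
          OF _ mult_rep_has_derivative[OF c d c']])
      (auto intro!: derivative_eq_intros)
  then show ?thesis
    by (rule has_derivative_transform_within_open[where s = "snd d ` fst d"])
      (use c_ d_ in \<open>auto simp: open_chart_image mult_rep_chart local_rep_def chart_inv_chart\<close>)
qed

lemma right_translation_has_derivative:
  assumes c: "c \<in> charts_at A p" and d: "d \<in> charts_at A a" and c': "c' \<in> charts_at A (p \<otimes> a)"
  shows "(local_rep (\<lambda>q. q \<otimes> a) c c' has_derivative
      (\<lambda>v. frechet_derivative (mult_rep c d c') (at (snd c p, snd d a)) (v, 0))) (at (snd c p))"
proof -
  note c_ = charts_atD[OF c] and d_ = charts_atD[OF d]
  have "((\<lambda>x. mult_rep c d c' (x, snd d a)) has_derivative
      (\<lambda>v. frechet_derivative (mult_rep c d c') (at (snd c p, snd d a)) (v, 0))) (at (snd c p))"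
    by (rule has_derivative_compose[where f = "\<lambda>x. (x, snd d a)" and g = "mult_rep c d c'",
          OF _ mult_rep_has_derivative[OF c d c']])
      (auto intro!: derivative_eq_intros)
  then show ?thesis
    by (rule has_derivative_transform_within_open[where s = "snd c ` fst c"])
      (use c_ d_ in \<open>auto simp: open_chart_image mult_rep_chart local_rep_def chart_inv_chart\<close>)
qed

lemma differentiable_at_point_left_translation:
  assumes "a \<in> carrier G" "p \<in> carrier G"
  shows "differentiable_at_point (\<lambda>q. a \<otimes> q) p"
proof -
  have "continuous_map X (prod_topology X X) (\<lambda>q. (a, q))"
    using assms by (auto simp: continuous_map_pairwise o_def topspace_X)
  from continuous_map_compose[OF this continuous_map_mult]
  have "continuous_map X X (\<lambda>q. a \<otimes> q)" by (simp add: o_def)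
  moreover obtain c where "c \<in> charts_at A a" using ex_chart_carrier[OF assms(1)] by blast
  ultimately show ?thesis
    using left_translation_has_derivative[of c a] assms
    unfolding differentiable_at_point_def topspace_X differentiable_def by blast
qed

lemma differentiable_at_point_right_translation:
  assumes "a \<in> carrier G" "p \<in> carrier G"
  shows "differentiable_at_point (\<lambda>q. q \<otimes> a) p"
proof -
  have "continuous_map X (prod_topology X X) (\<lambda>q. (q, a))"
    using assms by (auto simp: continuous_map_pairwise o_def topspace_X)
  from continuous_map_compose[OF this continuous_map_mult]
  have "continuous_map X X (\<lambda>q. q \<otimes> a)" by (simp add: o_def)
  moreover obtain d where "d \<in> charts_at A a" using ex_chart_carrier[OF assms(1)] by blast
  ultimately show ?thesis
    using right_translation_has_derivative[of _ _ d a] assms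
    unfolding differentiable_at_point_def topspace_X differentiable_def by blast
qed

lemma differential_left_translation:
  assumes c: "c \<in> charts_at A a" and d: "d \<in> charts_at A p" and c': "c' \<in> charts_at A (a \<otimes> p)"
    and v: "v \<in> tangent_space A p"
  shows "differential A A (\<lambda>q. a \<otimes> q) p v c' =
      frechet_derivative (mult_rep c d c') (at (snd c a, snd d p)) (0, v d)"
proof -
  have "a \<in> carrier G" "p \<in> carrier G"
    using charts_at_carrier[OF c] charts_at_carrier[OF d] by auto
  from differential_eq[OF differentiable_at_point_left_translation[OF this] v d c']
  show ?thesis
    using frechet_derivative_at[OF left_translation_has_derivative[OF c d c']] by metis
qed

lemma differential_right_translation:
  assumes c: "c \<in> charts_at A p" and d: "d \<in> charts_at A a" and c': "c' \<in> charts_at A (p \<otimes> a)"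
    and v: "v \<in> tangent_space A p"
  shows "differential A A (\<lambda>q. q \<otimes> a) p v c' =
      frechet_derivative (mult_rep c d c') (at (snd c p, snd d a)) (v c, 0)"
proof -
  have "a \<in> carrier G" "p \<in> carrier G"
    using charts_at_carrier[OF c] charts_at_carrier[OF d] by auto
  from differential_eq[OF differentiable_at_point_right_translation[OF this] v c c']
  show ?thesis
    using frechet_derivative_at[OF right_translation_has_derivative[OF c d c']] by metis
qed

end

section \<open>Orthonormal left-invariant frames\<close>

lemma differentiable_det_3:
  fixes M :: "'a::real_normed_vector \<Rightarrow> real^3^3"
  assumes "\<And>i j. (\<lambda>x. M x $ i $ j) differentiable (at x)"
  shows "(\<lambda>x. det (M x)) differentiable (at x)"
  unfolding det_3 by (intro differentiable_add differentiable_diff differentiable_mult assms)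

locale framed_lie_group = lie_grp G X A
  for G :: "('a, 'b) monoid_scheme" (structure) and X and A :: "('a, real^3) chart set" +
  fixes g :: "('a, real^3) metric" and E :: "3 \<Rightarrow> ('a, real^3) vfield"
  assumes biinv: "biinvariant_metric G X A g"
    and basis: "orthonormal_left_invariant_basis G A g E"
begin

lemma E_vector_field: "E i \<in> vector_fields A"
  using basis by (simp add: orthonormal_left_invariant_basis_def left_invariant_def)

lemma E_tangent: "E i p \<in> tangent_space A p"
  using E_vector_field[of i] by (simp add: vector_fields_def)

lemma E_left_invariant:
  "a \<in> carrier G \<Longrightarrow> p \<in> carrier G \<Longrightarrow> differential A A (\<lambda>q. a \<otimes> q) p (E i p) = E i (a \<otimes> p)"
  using basis by (simp add: orthonormal_left_invariant_basis_def left_invariant_def)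

lemma E_orthonormal: "p \<in> carrier G \<Longrightarrow> g p (E i p) (E j p) = (if i = j then 1 else 0)"
  using basis by (simp add: orthonormal_left_invariant_basis_def)

lemma field_rep_has_derivative:
  assumes "c \<in> charts_at A p"
  shows "(field_rep (E i) c has_derivative frechet_derivative (field_rep (E i) c) (at (snd c p))) (at (snd c p))"
proof -
  have "smooth_on (snd c ` fst c) (field_rep (E i) c)"
    using E_vector_field[of i] charts_atD[OF assms] by (simp add: vector_fields_def)
  then have "Ck_on (Suc 0) (snd c ` fst c) (field_rep (E i) c)" unfolding smooth_on_def by blast
  then show ?thesis
    by (rule Ck_on_has_derivative) (use charts_atD[OF assms] open_chart_image in auto)
qed

lemma field_rep_chart: "c \<in> charts_at A p \<Longrightarrow> field_rep V c (snd c p) = V p c"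
  using charts_atD by (simp add: field_rep_def chart_inv_chart)

lemma metric_riemannian: "riemannian_metric X A g"
  using biinv by (simp add: biinvariant_metric_def)

lemma metric_sym:
  "p \<in> carrier G \<Longrightarrow> u \<in> tangent_space A p \<Longrightarrow> v \<in> tangent_space A p \<Longrightarrow> g p u v = g p v u"
  using metric_riemannian unfolding riemannian_metric_def topspace_X by blast

lemma metric_lincomb:
  assumes "p \<in> carrier G" "u \<in> tangent_space A p" "v \<in> tangent_space A p" "w \<in> tangent_space A p"
  shows "g p (\<lambda>c. a *\<^sub>R u c + b *\<^sub>R v c) w = a * g p u w + b * g p v w"
  using metric_riemannian assms unfolding riemannian_metric_def topspace_X by blast

lemma metric_zero: "p \<in> carrier G \<Longrightarrow> w \<in> tangent_space A p \<Longrightarrow> g p (\<lambda>c. 0) w = 0"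
  using metric_lincomb[of p w w w 0 0] by simp

lemma metric_sum:
  assumes p: "p \<in> carrier G" and v: "\<And>i. v i \<in> tangent_space A p" and w: "w \<in> tangent_space A p"
    and "finite S"
  shows "g p (\<lambda>c. \<Sum>i\<in>S. a i *\<^sub>R v i c) w = (\<Sum>i\<in>S. a i * g p (v i) w)"
  using \<open>finite S\<close>
proof (induction S)
  case (insert i S)
  have "(\<lambda>c. \<Sum>i\<in>S. a i *\<^sub>R v i c) \<in> tangent_space A p"
    using p v by (intro tangent_space_sum) (auto simp: topspace_X)
  from metric_lincomb[OF p v[of i] this w, of "a i" 1] insert show ?case by simp
qed (simp add: metric_zero p w)

lemma metric_frame_coeff:
  fixes a :: "3 \<Rightarrow> real"
  assumes p: "p \<in> carrier G"
  shows "g p (\<lambda>c. \<Sum>j\<in>UNIV. a j *\<^sub>R E j p c) (E k p) = a k"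
  by (simp add: metric_sum[OF p E_tangent E_tangent] E_orthonormal[OF p]
      if_distrib[of "\<lambda>x. _ * x"] cong: if_cong)

definition frame_matrix :: "('a, real^3) chart \<Rightarrow> 'a \<Rightarrow> real^3^3" where
  "frame_matrix c p = (\<chi> r j. E j p c $ r)"

lemma frame_matrix_mult: "frame_matrix c p *v a = (\<Sum>j\<in>UNIV. (a $ j) *\<^sub>R E j p c)"
  by (simp add: vec_eq_iff frame_matrix_def matrix_vector_mult_def mult.commute)

text \<open>
  Orthonormal vectors are linearly independent, and a tangent vector vanishes if its
  coordinates in one chart do.
\<close>

lemma det_frame_matrix:
  assumes c: "c \<in> charts_at A p"
  shows "det (frame_matrix c p) \<noteq> 0"
proof -
  have p: "p \<in> carrier G" using charts_at_carrier[OF c] .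
  have "a = 0" if a: "frame_matrix c p *v a = 0" for a
  proof -
    have "(\<lambda>d. \<Sum>j\<in>UNIV. (a $ j) *\<^sub>R E j p d) = (\<lambda>d. \<Sum>j\<in>UNIV. 0 *\<^sub>R E j p d)"
      using a p by (intro tangent_vector_eqI[OF _ _ c] tangent_space_sum E_tangent)
        (auto simp: frame_matrix_mult topspace_X)
    then have "a $ k = 0" for k
      using metric_frame_coeff[OF p, of "\<lambda>j. a $ j" k] metric_zero[OF p E_tangent, of k] by simp
    then show ?thesis by (simp add: vec_eq_iff)
  qed
  then have "invertible (frame_matrix c p)"
    unfolding invertible_left_inverse matrix_left_invertible_ker by blast
  then show ?thesis by (simp add: invertible_det_nz)
qed

text \<open>
  The space is three-dimensional like the coordinate space, so three linearly independent
  tangent vectors span.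
\<close>

lemma frame_expansion:
  assumes p: "p \<in> carrier G" and v: "v \<in> tangent_space A p"
  shows "v = (\<lambda>c. \<Sum>j\<in>UNIV. g p v (E j p) *\<^sub>R E j p c)"
proof -
  obtain c where c: "c \<in> charts_at A p" using ex_chart_carrier[OF p] by blast
  from cramer[OF det_frame_matrix[OF c]]
  obtain a where a: "frame_matrix c p *v a = v c" by blast
  have "v = (\<lambda>d. \<Sum>j\<in>UNIV. (a $ j) *\<^sub>R E j p d)"
    using a p v by (intro tangent_vector_eqI[OF _ _ c] tangent_space_sum E_tangent)
      (auto simp: frame_matrix_mult topspace_X)
  moreover from this have "g p v (E k p) = a $ k" for k
    using metric_frame_coeff[OF p, of "\<lambda>j. a $ j" k] by simp
  ultimately show ?thesis by simp
qed

subsection \<open>The adjoint representation in the frame\<close>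

text \<open>
  The matrix of \<open>Ad (b\<^sup>-\<^sup>1)\<close> in the frame: identifying tangent spaces by left translation,
  right translation by \<open>b\<close> is the adjoint action of \<open>b\<^sup>-\<^sup>1\<close>.
\<close>

definition ad_coeff :: "3 \<Rightarrow> 3 \<Rightarrow> 'a \<Rightarrow> real" where
  "ad_coeff i j b = g b (differential A A (\<lambda>q. q \<otimes> b) \<one> (E i \<one>)) (E j b)"

lemma ad_coeff_one: "ad_coeff i j \<one> = (if i = j then 1 else 0)"
proof -
  have "differential A A (\<lambda>q. q \<otimes> \<one>) \<one> (E i \<one>) = differential A A (\<lambda>q. \<one> \<otimes> q) \<one> (E i \<one>)"
    by (rule differential_cong[OF differentiable_at_point_right_translation]) (auto simp: topspace_X)
  also have "\<dots> = E i \<one>" using E_left_invariant[of \<one> \<one> i] by simp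
  finally show ?thesis by (simp add: ad_coeff_def E_orthonormal)
qed

lemma right_translation_frame_one:
  assumes b: "b \<in> carrier G"
  shows "differential A A (\<lambda>q. q \<otimes> b) \<one> (E i \<one>) = (\<lambda>c. \<Sum>j\<in>UNIV. ad_coeff i j b *\<^sub>R E j b c)"
  unfolding ad_coeff_def
  using differential_in_tangent_space[OF differentiable_at_point_right_translation[OF b one_closed] E_tangent, of i] b
  by (intro frame_expansion) simp_all

text \<open>
  Left translation by \<open>p\<close> carries the defining equation at the identity to the point \<open>p\<close>,
  since it commutes with right translation by \<open>b\<close> and preserves the frame.  This is why the
  same coefficients serve at every point.
\<close>

lemma right_translation_frame:
  assumes b: "b \<in> carrier G" and p: "p \<in> carrier G"
  shows "differential A A (\<lambda>q. q \<otimes> b) p (E i p) = (\<lambda>c. \<Sum>j\<in>UNIV. ad_coeff i j b *\<^sub>R E j (p \<otimes> b) c)"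
proof -
  let ?L = "\<lambda>q. p \<otimes> q" and ?R = "\<lambda>q. q \<otimes> b"
  note L = differentiable_at_point_left_translation[OF p]
    and R = differentiable_at_point_right_translation[OF b]
  have "differential A A ?R p (E i p) = differential A A ?R (?L \<one>) (differential A A ?L \<one> (E i \<one>))"
    using p by (simp add: E_left_invariant)
  also have "\<dots> = differential A A (?R \<circ> ?L) \<one> (E i \<one>)"
    using p by (intro differential_compose[symmetric] L R E_tangent) auto
  also have "\<dots> = differential A A (?L \<circ> ?R) \<one> (E i \<one>)"
    using p b by (intro differential_cong differentiable_at_point_compose L R) (auto simp: topspace_X m_assoc)
  also have "\<dots> = differential A A ?L (?R \<one>) (differential A A ?R \<one> (E i \<one>))"
    using b by (intro differential_compose L R E_tangent) auto
  also have "\<dots> = differential A A ?L b (\<lambda>c. \<Sum>j\<in>UNIV. ad_coeff i j b *\<^sub>R E j b c)"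
    using b by (simp add: right_translation_frame_one)
  also have "\<dots> = (\<lambda>c. \<Sum>j\<in>UNIV. ad_coeff i j b *\<^sub>R differential A A ?L b (E j b) c)"
    using b by (intro differential_linear L E_tangent) auto
  also have "\<dots> = (\<lambda>c. \<Sum>j\<in>UNIV. ad_coeff i j b *\<^sub>R E j (p \<otimes> b) c)"
    using p b by (simp add: E_left_invariant)
  finally show ?thesis .
qed

text \<open>
  Right translations are isometries and the frame is orthonormal at both points.
\<close>

lemma ad_coeff_orthogonal:
  assumes b: "b \<in> carrier G"
  shows "(\<Sum>j\<in>UNIV. ad_coeff i j b * ad_coeff k j b) = (if i = k then 1 else 0)"
proof -
  let ?F = "\<lambda>i c. \<Sum>j\<in>UNIV. ad_coeff i j b *\<^sub>R E j b c"
  have F: "?F i \<in> tangent_space A b" for i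
    using b by (intro tangent_space_sum E_tangent) (simp add: topspace_X)
  have "g (\<one> \<otimes> b) (differential A A (\<lambda>q. q \<otimes> b) \<one> (E i \<one>)) (differential A A (\<lambda>q. q \<otimes> b) \<one> (E k \<one>))
      = g \<one> (E i \<one>) (E k \<one>)"
    using biinv b E_tangent unfolding biinvariant_metric_def by blast
  then have "g b (?F i) (?F k) = (if i = k then 1 else 0)"
    using b by (simp add: right_translation_frame_one E_orthonormal)
  moreover have "g b (?F i) (?F k) = (\<Sum>j\<in>UNIV. ad_coeff i j b * g b (E j b) (?F k))"
    using b by (intro metric_sum E_tangent F) auto
  moreover have "g b (E j b) (?F k) = ad_coeff k j b" for j
    using metric_sym[OF b E_tangent F, of j k] metric_frame_coeff[OF b] by simp
  ultimately show ?thesis by simp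
qed

text \<open>
  In a chart, the row \<open>a\<^sub>i\<close> of coefficients solves a linear system whose matrix consists of the
  frame vectors and whose right-hand side is a partial derivative of the multiplication.  Both
  are differentiable, and Cramer's rule writes the solution as a quotient of determinants.
\<close>

lemma ad_coeff_differentiable:
  assumes c: "c \<in> charts_at A \<one>"
  shows "(\<lambda>y. ad_coeff i j (chart_inv c y)) differentiable (at (snd c \<one>))"
proof -
  note c_ = charts_atD[OF c]
  define F where "F y = frechet_derivative (mult_rep c c c) (at (snd c \<one>, y)) (E i \<one> c, 0)" for y
  define V where "V y = (\<chi> r j. field_rep (E j) c y $ r)" for y
  have c1: "c \<in> charts_at A (\<one> \<otimes> \<one>)" using c by simp
  have W: "(snd c \<one>, snd c \<one>) \<in> mult_dom c c c"
    using c_ by (intro mult_dom_chart) auto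
  have "((\<lambda>y. F y) has_derivative (\<lambda>v. frechet_derivative (\<lambda>z. frechet_derivative (mult_rep c c c)
      (at z within mult_dom c c c) (E i \<one> c, 0)) (at (snd c \<one>, snd c \<one>)) (0, v))) (at (snd c \<one>))"
    unfolding F_def using c_
    by (intro has_derivative_compose[where f = "\<lambda>y. (snd c \<one>, y)" and
          g = "\<lambda>z. frechet_derivative (mult_rep c c c) (at z) (E i \<one> c, 0)",
          OF _ Ck_on_second_derivative[OF Ck_on_mult_rep open_mult_dom W]])
      (auto intro!: derivative_eq_intros)
  then have F: "(\<lambda>y. F y $ r) differentiable (at (snd c \<one>))" for r
    using bounded_linear.has_derivative[OF bounded_linear_vec_nth] unfolding differentiable_def by blast
  have V: "(\<lambda>y. V y $ r $ s) differentiable (at (snd c \<one>))" for r s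
    using bounded_linear.has_derivative[OF bounded_linear_vec_nth field_rep_has_derivative[OF c]]
    by (auto simp: differentiable_def V_def)
  have V_eq: "V (snd c q) = frame_matrix c q" if "q \<in> fst c" for q
    using that c_ by (simp add: V_def frame_matrix_def field_rep_def chart_inv_chart)
  have eq: "ad_coeff i j (chart_inv c y) =
      det (\<chi> r s. if s = j then F y $ r else V y $ r $ s) / det (V y)" if y: "y \<in> snd c ` fst c" for y
  proof -
    obtain q where q: "q \<in> fst c" "y = snd c q" using y by auto
    then have cq: "c \<in> charts_at A q" and q': "q \<in> carrier G"
      using c_ chart_domain_subset[of c] topspace_X by (auto simp: charts_at_def)
    have "F y = differential A A (\<lambda>p. p \<otimes> q) \<one> (E i \<one>) c"
      using differential_right_translation[OF c cq _ E_tangent, of c i] cq q' by (simp add: F_def q)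
    also have "\<dots> = V y *v (\<chi> j. ad_coeff i j q)"
      using q q' by (simp add: right_translation_frame_one V_eq frame_matrix_mult)
    finally have "(\<chi> j. ad_coeff i j q) =
        (\<chi> k. det (\<chi> r s. if s = k then F y $ r else V y $ r $ s) / det (V y))"
      using cramer[OF det_frame_matrix[OF cq], of "\<chi> j. ad_coeff i j q" "F y"] V_eq[OF q(1)]
      unfolding q(2) by metis
    then have "(\<chi> j. ad_coeff i j q) $ j =
        (\<chi> k. det (\<chi> r s. if s = k then F y $ r else V y $ r $ s) / det (V y)) $ j"
      by (rule arg_cong)
    moreover have "chart_inv c y = q" using q c_ by (simp add: chart_inv_chart)
    ultimately show ?thesis by (simp only: vec_lambda_beta)
  qed
  have "(\<lambda>y. det (\<chi> r s. if s = j then F y $ r else V y $ r $ s) / det (V y)) differentiable (at (snd c \<one>))"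
  proof (intro differentiable_divide differentiable_det_3 V)
    show "(\<lambda>y. (\<chi> r s. if s = j then F y $ r else V y $ r $ s) $ i' $ j') differentiable (at (snd c \<one>))" for i' j'
      using F V by (cases "j' = j") auto
  qed (use c c_ in \<open>simp add: V_eq det_frame_matrix\<close>)
  then obtain D where "((\<lambda>y. det (\<chi> r s. if s = j then F y $ r else V y $ r $ s) / det (V y)) has_derivative D) (at (snd c \<one>))"
    unfolding differentiable_def by blast
  then have "((\<lambda>y. ad_coeff i j (chart_inv c y)) has_derivative D) (at (snd c \<one>))"
    by (rule has_derivative_transform_within_open[OF _ open_chart_image]) (use c_ eq in auto)
  then show ?thesis unfolding differentiable_def by blast
qed

definition ad_deriv :: "3 \<Rightarrow> 3 \<Rightarrow> 3 \<Rightarrow> real" where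
  "ad_deriv i j k = (let c = (SOME c. c \<in> charts_at A \<one>)
     in frechet_derivative (\<lambda>y. ad_coeff i j (chart_inv c y)) (at (snd c \<one>)) (E k \<one> c))"

text \<open>
  Differentiate \<open>\<Sum>\<^sub>l a\<^sub>i\<^sub>l a\<^sub>j\<^sub>l = \<delta>\<^sub>i\<^sub>j\<close> at the identity, where the matrix is the unit matrix.
\<close>

lemma ad_deriv_skew: "ad_deriv i j k = - ad_deriv j i k"
proof -
  define c where "c = (SOME c. c \<in> charts_at A \<one>)"
  have c: "c \<in> charts_at A \<one>" unfolding c_def by (rule some_chart) (simp add: topspace_X)
  note c_ = charts_atD[OF c]
  let ?M = "\<lambda>i j y. ad_coeff i j (chart_inv c y)"
  let ?D = "\<lambda>i j. frechet_derivative (?M i j) (at (snd c \<one>))"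
  have D: "(?M i j has_derivative ?D i j) (at (snd c \<one>))" for i j
    using ad_coeff_differentiable[OF c] frechet_derivative_works by blast
  have M1: "?M i j (snd c \<one>) = (if i = j then 1 else 0)" for i j
    using c_ by (simp add: chart_inv_chart ad_coeff_one)
  have "((\<lambda>y. \<Sum>l\<in>UNIV. ?M i l y * ?M j l y) has_derivative
      (\<lambda>v. \<Sum>l\<in>UNIV. ?M i l (snd c \<one>) * ?D j l v + ?D i l v * ?M j l (snd c \<one>))) (at (snd c \<one>))"
    by (intro has_derivative_sum has_derivative_mult D)
  then have "((\<lambda>y. if i = j then 1 else 0 :: real) has_derivative
      (\<lambda>v. \<Sum>l\<in>UNIV. ?M i l (snd c \<one>) * ?D j l v + ?D i l v * ?M j l (snd c \<one>))) (at (snd c \<one>))"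
    by (rule has_derivative_transform_within_open[OF _ open_chart_image])
      (use c_ chart_domain_subset[of c] in \<open>auto simp: ad_coeff_orthogonal chart_inv_chart topspace_X\<close>)
  then have "(\<lambda>v. \<Sum>l\<in>UNIV. ?M i l (snd c \<one>) * ?D j l v + ?D i l v * ?M j l (snd c \<one>)) = (\<lambda>v. 0)"
    using has_derivative_unique has_derivative_const by blast
  then have "(\<Sum>l\<in>UNIV. ?M i l (snd c \<one>) * ?D j l v + ?D i l v * ?M j l (snd c \<one>)) = 0" for v
    by meson
  then have "?D j i v + ?D i j v = 0" for v
    unfolding M1 by (simp add: sum.distrib if_distrib[of "\<lambda>x. x * _"] if_distrib[of "\<lambda>x. _ * x"] cong: if_cong)
  then show ?thesis
    by (simp add: ad_deriv_def c_def[symmetric] Let_def eq_neg_iff_add_eq_0 add.commute)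
qed

text \<open>
  Write \<open>m (x, y)\<close> for the multiplication in charts around \<open>p\<close> and the identity, \<open>y\<^sub>0\<close> for the
  coordinates of the identity, \<open>\<epsilon>\<^sub>i\<close> for the coordinates of \<open>E\<^sub>i\<close> at the identity, and \<open>V\<^sub>i\<close> for the
  coordinates of the field \<open>E\<^sub>i\<close> near \<open>p\<close>.  Left invariance gives \<open>V\<^sub>i(x) = \<partial>\<^sub>2 m(x, y\<^sub>0) \<epsilon>\<^sub>i\<close>, so the
  derivative of \<open>V\<^sub>i\<close> is the mixed second derivative of \<open>m\<close>.  The transformation of the frame under
  right translation reads \<open>\<partial>\<^sub>1 m(x, y) V\<^sub>i(x) = \<Sum>\<^sub>j a\<^sub>i\<^sub>j(y) V\<^sub>j(m(x, y))\<close>.  Its derivative with respect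
  to \<open>y\<close> at \<open>y\<^sub>0\<close> in the direction \<open>\<epsilon>\<^sub>k\<close> is
  \<open>\<partial>\<^sub>2 \<partial>\<^sub>1 m (\<epsilon>\<^sub>k, V\<^sub>i) = DV\<^sub>i V\<^sub>k + \<Sum>\<^sub>j (\<partial>\<^sub>k a\<^sub>i\<^sub>j) V\<^sub>j\<close>, and by the symmetry of second derivatives the
  left-hand side is \<open>DV\<^sub>k V\<^sub>i\<close>.
\<close>

lemma lie_bracket_frame_chart:
  assumes c: "c \<in> charts_at A p"
  shows "lie_bracket A (E i) (E k) p c = (\<Sum>j\<in>UNIV. ad_deriv i j k *\<^sub>R E j p c)"
proof -
  define e where "e = (SOME c. c \<in> charts_at A \<one>)"
  have e: "e \<in> charts_at A \<one>" unfolding e_def by (rule some_chart) (simp add: topspace_X)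
  note c_ = charts_atD[OF c] and e_ = charts_atD[OF e]
  have p: "p \<in> carrier G" using charts_at_carrier[OF c] .
  let ?m = "mult_rep c e c" and ?W = "mult_dom c e c"
  let ?x = "snd c p" and ?y = "snd e \<one>"
  let ?H = "\<lambda>u. frechet_derivative (\<lambda>z. frechet_derivative ?m (at z) u) (at (?x, ?y))"
  let ?V = "\<lambda>i. field_rep (E i) c"
  let ?M = "\<lambda>i j y. ad_coeff i j (chart_inv e y)"
  have W: "(?x, ?y) \<in> ?W" using c_ e_ p by (intro mult_dom_chart) auto
  have oW: "open ?W" using c_ e_ open_mult_dom by blast
  have Ck: "Ck_on k ?W ?m" for k using c_ e_ Ck_on_mult_rep by blast
  have H: "((\<lambda>z. frechet_derivative ?m (at z) u) has_derivative ?H u) (at (?x, ?y))" for u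
    using Ck_on_second_derivative[OF Ck oW W] by (metis frechet_derivative_at)
  have V: "?V i (snd c q) = frechet_derivative ?m (at (snd c q, ?y)) (0, E i \<one> e)"
    if q: "q \<in> fst c" for q i
  proof -
    have cq: "c \<in> charts_at A q" and q': "q \<in> carrier G"
      using q c_ chart_domain_subset[of c] topspace_X by (auto simp: charts_at_def)
    show ?thesis
      using differential_left_translation[OF cq e _ E_tangent, of c i] E_left_invariant[of q \<one> i] cq q'
      by (simp add: field_rep_chart)
  qed
  have dV: "frechet_derivative (?V i) (at ?x) v = ?H (0, E i \<one> e) (v, 0)" for i v
  proof -
    have "((\<lambda>x. frechet_derivative ?m (at (x, ?y)) (0, E i \<one> e)) has_derivative
        (\<lambda>v. ?H (0, E i \<one> e) (v, 0))) (at ?x)"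
      by (rule has_derivative_compose[where f = "\<lambda>x. (x, ?y)" and
            g = "\<lambda>z. frechet_derivative ?m (at z) (0, E i \<one> e)", OF _ H])
        (auto intro!: derivative_eq_intros)
    then have "(?V i has_derivative (\<lambda>v. ?H (0, E i \<one> e) (v, 0))) (at ?x)"
      by (rule has_derivative_transform_within_open[OF _ open_chart_image]) (use c_ V in auto)
    then show ?thesis using frechet_derivative_at by metis
  qed
  have mx: "?m (?x, ?y) = ?x" using c_ e_ p by (simp add: mult_rep_chart)
  \<comment> \<open>The transformation of the frame under right translation by the point with coordinates \<open>y\<close>.\<close>
  have right: "frechet_derivative ?m (at (?x, y)) (E i p c, 0) = (\<Sum>j\<in>UNIV. ?M i j y *\<^sub>R ?V j (?m (?x, y)))"
    if y: "(?x, y) \<in> ?W" for y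
  proof -
    obtain p' b where "?x = snd c p'" "y = snd e b" "p' \<in> fst c" "b \<in> fst e" "p' \<otimes> b \<in> fst c"
      using mult_domE[OF y] by (metis prod.inject)
    then have b: "y = snd e b" "b \<in> fst e" "p \<otimes> b \<in> fst c"
      using chart_inj c_ by (metis inj_onD)+
    then have eb: "e \<in> charts_at A b" and cb: "c \<in> charts_at A (p \<otimes> b)" and b': "b \<in> carrier G"
      using c_ e_ chart_domain_subset[of e] topspace_X by (auto simp: charts_at_def)
    show ?thesis
      using differential_right_translation[OF c eb cb E_tangent, of i] right_translation_frame[OF b' p, of i]
        b c_ e_ cb by (simp add: mult_rep_chart chart_inv_chart field_rep_chart)
  qed
  have "((\<lambda>y. \<Sum>j\<in>UNIV. ?M i j y *\<^sub>R ?V j (?m (?x, y))) has_derivative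
      (\<lambda>w. \<Sum>j\<in>UNIV. ?M i j ?y *\<^sub>R frechet_derivative (?V j) (at ?x) (frechet_derivative ?m (at (?x, ?y)) (0, w))
        + frechet_derivative (?M i j) (at ?y) w *\<^sub>R ?V j (?m (?x, ?y)))) (at ?y)"
  proof (intro has_derivative_sum has_derivative_scaleR)
    fix j
    show "(?M i j has_derivative frechet_derivative (?M i j) (at ?y)) (at ?y)"
      using ad_coeff_differentiable[OF e] frechet_derivative_works by blast
    have "((\<lambda>y. ?m (?x, y)) has_derivative (\<lambda>w. frechet_derivative ?m (at (?x, ?y)) (0, w))) (at ?y)"
      by (rule has_derivative_compose[where f = "\<lambda>y. (?x, y)" and g = ?m, OF _ Ck_on_has_derivative[OF Ck oW W]])
        (auto intro!: derivative_eq_intros)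
    then show "((\<lambda>y. ?V j (?m (?x, y))) has_derivative
        (\<lambda>w. frechet_derivative (?V j) (at ?x) (frechet_derivative ?m (at (?x, ?y)) (0, w)))) (at ?y)"
      by (rule has_derivative_compose) (simp add: mx field_rep_has_derivative[OF c])
  qed
  \<comment> \<open>The same function is a partial derivative of the multiplication.\<close>
  moreover have "((\<lambda>y. \<Sum>j\<in>UNIV. ?M i j y *\<^sub>R ?V j (?m (?x, y))) has_derivative
      (\<lambda>w. ?H (E i p c, 0) (0, w))) (at ?y)"
  proof -
    have "((\<lambda>y. frechet_derivative ?m (at (?x, y)) (E i p c, 0)) has_derivative
        (\<lambda>w. ?H (E i p c, 0) (0, w))) (at ?y)"
      by (rule has_derivative_compose[where f = "\<lambda>y. (?x, y)" and
            g = "\<lambda>z. frechet_derivative ?m (at z) (E i p c, 0)", OF _ H])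
        (auto intro!: derivative_eq_intros)
    then show ?thesis
    proof (rule has_derivative_transform_within_open[where s = "(\<lambda>y. (?x, y)) -` ?W"])
      show "open ((\<lambda>y. (?x, y)) -` ?W)"
        by (intro open_vimage oW continuous_intros)
    qed (use W right in auto)
  qed
  ultimately have "?H (E i p c, 0) (0, E k \<one> e) =
      (\<Sum>j\<in>UNIV. ?M i j ?y *\<^sub>R frechet_derivative (?V j) (at ?x) (frechet_derivative ?m (at (?x, ?y)) (0, E k \<one> e))
        + frechet_derivative (?M i j) (at ?y) (E k \<one> e) *\<^sub>R ?V j (?m (?x, ?y)))"
    by (auto dest: has_derivative_unique dest!: fun_cong[where x = "E k \<one> e"])
  also have "\<dots> = (\<Sum>j\<in>UNIV. ?M i j ?y *\<^sub>R frechet_derivative (?V j) (at ?x) (E k p c)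
        + ad_deriv i j k *\<^sub>R E j p c)"
    using V[of p k] c c_ by (simp add: ad_deriv_def Let_def e_def[symmetric] mx field_rep_chart)
  also have "\<dots> = frechet_derivative (?V i) (at ?x) (E k p c) + (\<Sum>j\<in>UNIV. ad_deriv i j k *\<^sub>R E j p c)"
    using e_ by (simp add: sum.distrib chart_inv_chart ad_coeff_one if_distrib[of "\<lambda>x. x *\<^sub>R _"] cong: if_cong)
  finally have "?H (E i p c, 0) (0, E k \<one> e) =
      frechet_derivative (?V i) (at ?x) (E k p c) + (\<Sum>j\<in>UNIV. ad_deriv i j k *\<^sub>R E j p c)" .
  moreover have "?H (E i p c, 0) (0, E k \<one> e) = frechet_derivative (?V k) (at ?x) (E i p c)"
    unfolding dV by (rule symmetric_second_derivative[OF Ck oW W])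
  ultimately show ?thesis
    using c by (simp add: lie_bracket_def)
qed

lemma lie_bracket_frame:
  "lie_bracket A (E i) (E k) p = (\<lambda>c. \<Sum>j\<in>UNIV. ad_deriv i j k *\<^sub>R E j p c)"
proof
  fix c
  show "lie_bracket A (E i) (E k) p c = (\<Sum>j\<in>UNIV. ad_deriv i j k *\<^sub>R E j p c)"
    by (cases "c \<in> charts_at A p")
      (simp_all add: lie_bracket_frame_chart tangent_space_outside[OF E_tangent], simp add: lie_bracket_def)
qed

end

section \<open>Structure constants and the Levi-Civita connection\<close>

context framed_lie_group
begin

definition struct_const :: "3 \<Rightarrow> 3 \<Rightarrow> 3 \<Rightarrow> real" where
  "struct_const i j k = g \<one> (lie_bracket A (E i) (E j) \<one>) (E k \<one>)"

lemma lie_bracket_coeff: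
  assumes "p \<in> carrier G"
  shows "g p (lie_bracket A (E i) (E j) p) (E k p) = ad_deriv i k j"
  by (simp add: lie_bracket_frame metric_frame_coeff[OF assms])

lemma struct_const_at:
  assumes "p \<in> carrier G"
  shows "g p (lie_bracket A (E i) (E j) p) (E k p) = struct_const i j k"
  by (simp add: lie_bracket_coeff[OF assms] lie_bracket_coeff struct_const_def)

text \<open>
  Skewness in the first two indices is that of the bracket; skewness in the first and third
  is that of the derivative of the adjoint representation.  Together they generate the rest.
\<close>

lemma struct_const_skew:
  "struct_const j i k = - struct_const i j k" "struct_const i k j = - struct_const i j k"
proof -
  have skew1: "struct_const i j k = - struct_const k j i" for i j k
    using ad_deriv_skew[of i k j] by (simp add: struct_const_def lie_bracket_coeff)
  have tangent: "lie_bracket A (E i) (E j) \<one> \<in> tangent_space A \<one>" for i j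
    unfolding lie_bracket_frame by (intro tangent_space_sum E_tangent) (simp add: topspace_X)
  have skew2: "struct_const j i k = - struct_const i j k" for i j k
  proof -
    have "lie_bracket A (E j) (E i) \<one> = (\<lambda>c. (-1) *\<^sub>R lie_bracket A (E i) (E j) \<one> c + 0 *\<^sub>R E i \<one> c)"
      by (simp add: lie_bracket_def fun_eq_iff)
    then show ?thesis
      using metric_lincomb[OF one_closed tangent[of i j] E_tangent[of i] E_tangent[of k], of "-1" 0]
      by (simp only: struct_const_def)
  qed
  show "struct_const j i k = - struct_const i j k" by (rule skew2)
  show "struct_const i k j = - struct_const i j k" using skew1 skew2 by metis
qed

text \<open>
  The products \<open>\<langle>E\<^sub>j, E\<^sub>k\<rangle>\<close> are constant, so compatibility with the metric makes
  \<open>\<Gamma>\<^sub>i\<^sub>j\<^sub>k = \<langle>D\<^bsub>E\<^sub>i\<^esub> E\<^sub>j, E\<^sub>k\<rangle>\<close> skew in \<open>j\<close> and \<open>k\<close>, and freeness of torsion says that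
  \<open>\<Gamma>\<^sub>i\<^sub>j\<^sub>k - \<Gamma>\<^sub>j\<^sub>i\<^sub>k\<close> is the structure constant.  These relations for the three cyclic
  permutations of the indices, for which the structure constants coincide, determine \<open>\<Gamma>\<close>.
\<close>

lemma connection_coeff:
  assumes D: "levi_civita X A g D" and p: "p \<in> carrier G"
  shows "g p (D (E i) (E j) p) (E k p) = struct_const i j k / 2"
proof -
  let ?\<Gamma> = "\<lambda>i j k. g p (D (E i) (E j) p) (E k p)"
  have T: "D (E i) (E j) p \<in> tangent_space A p" for i j
    using D E_vector_field by (auto simp: levi_civita_def affine_connection_def vector_fields_def)
  have skew: "?\<Gamma> i j k = - ?\<Gamma> i k j" for i j k
  proof -
    define c where "c = (SOME c. c \<in> charts_at A p)"
    have c: "c \<in> charts_at A p" unfolding c_def using p by (intro some_chart) (simp add: topspace_X)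
    note c_ = charts_atD[OF c]
    \<comment> \<open>The product is constant on the group only, so its derivative is computed on a chart domain.\<close>
    have "((\<lambda>q. g q (E j q) (E k q)) \<circ> chart_inv c has_derivative (\<lambda>v. 0)) (at (snd c p))"
    proof (rule has_derivative_transform_within_open[OF has_derivative_const open_chart_image])
      fix x assume "x \<in> snd c ` fst c"
      then obtain q where q: "q \<in> fst c" "x = snd c q" by auto
      then have "q \<in> carrier G" using c_ chart_domain_subset[of c] topspace_X by auto
      then show "(if j = k then 1 else 0) = ((\<lambda>q. g q (E j q) (E k q)) \<circ> chart_inv c) x"
        using c_ q by (simp add: chart_inv_chart E_orthonormal)
    qed (use c_ in auto)
    from frechet_derivative_at[OF this, symmetric]
    have "vf_deriv A (E i) (\<lambda>q. g q (E j q) (E k q)) p = 0"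
      by (simp add: vf_deriv_def c_def[symmetric])
    moreover have "vf_deriv A (E i) (\<lambda>q. g q (E j q) (E k q)) p =
        g p (D (E i) (E j) p) (E k p) + g p (E j p) (D (E i) (E k) p)"
      using D E_vector_field p unfolding levi_civita_def topspace_X by blast
    ultimately show ?thesis using metric_sym[OF p E_tangent T, of j i k] by simp
  qed
  have tor: "?\<Gamma> i j k - ?\<Gamma> j i k = struct_const i j k" for i j k
  proof -
    have "lie_bracket A (E i) (E j) p = (\<lambda>c. 1 *\<^sub>R D (E i) (E j) p c + (-1) *\<^sub>R D (E j) (E i) p c)"
    proof
      fix c
      have "D (E i) (E j) p c - D (E j) (E i) p c = lie_bracket A (E i) (E j) p c"
        using D E_vector_field unfolding levi_civita_def by blast
      then show "lie_bracket A (E i) (E j) p c = 1 *\<^sub>R D (E i) (E j) p c + (-1) *\<^sub>R D (E j) (E i) p c"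
        by simp
    qed
    then have "g p (lie_bracket A (E i) (E j) p) (E k p) = ?\<Gamma> i j k - ?\<Gamma> j i k"
      using metric_lincomb[OF p T[of i j] T[of j i] E_tangent[of k], of 1 "-1"] by simp
    then show ?thesis by (simp add: struct_const_at[OF p])
  qed
  have "struct_const j k i = struct_const i j k" "struct_const k i j = struct_const i j k"
    using struct_const_skew(1)[where i = i and j = j and k = k]
      struct_const_skew(2)[where i = j and j = i and k = k]
      struct_const_skew(2)[where i = i and j = j and k = k]
      struct_const_skew(1)[where i = i and j = k and k = j] by linarith+
  then show ?thesis
    using tor[of i j k] tor[of j k i] tor[of k i j] skew[of i j k] skew[of j k i] skew[of k i j]
    by linarith
qed

end

section \<open>The bracket as a cross product\<close>

text \<open>
  Up to a factor the determinant is the only alternating trilinear form in dimension three.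
\<close>

lemma alternating_form_cross3:
  fixes C :: "3 \<Rightarrow> 3 \<Rightarrow> 3 \<Rightarrow> real" and u v :: "real^3"
  assumes skew1: "\<And>i j k. C j i k = - C i j k" and skew2: "\<And>i j k. C i k j = - C i j k"
  shows "(\<chi> k. \<Sum>i\<in>UNIV. \<Sum>j\<in>UNIV. u $ i * v $ j * C i j k) = C 1 2 3 *\<^sub>R cross3 u v"
proof -
  have 1: "C i i k = 0" for i k using skew1[of i i k] by simp
  have 2: "C i k k = 0" for i k using skew2[of i k k] by simp
  have 3: "C i k i = 0" for i k using skew2[of i i k] 1 by simp
  have "C 2 1 3 = - C 1 2 3" "C 1 3 2 = - C 1 2 3" "C 3 1 2 = C 1 2 3" "C 2 3 1 = C 1 2 3"
    "C 3 2 1 = - C 1 2 3"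
    using skew1[of 2 1 3] skew2[of 1 3 2] skew1[of 3 1 2] skew2[of 2 3 1] skew1[of 3 2 1] by simp_all
  then show ?thesis
    by (simp add: vec_eq_iff forall_3 sum_3 cross3_def vector_def 1 2 3 algebra_simps)
qed

context framed_lie_group
begin

text \<open>
  The constant \<open>c\<close> with \<open>[u, v] / 2 = c (u \<times> v)\<close>.
\<close>

definition half_bracket :: real where "half_bracket = struct_const 1 2 3 / 2"

lemma alg_bracket_cross3: "alg_bracket G A g E u v = (2 * half_bracket) *\<^sub>R cross3 u v"
  using alternating_form_cross3[of struct_const u v, OF struct_const_skew]
  by (simp add: alg_bracket_def struct_const_def[symmetric] half_bracket_def)

lemma cov_deriv_cross3:
  assumes D: "levi_civita X A g D" and "\<gamma> t \<in> carrier G"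
  shows "cov_deriv g D E I \<gamma> T U t = vector_derivative U (at t within I) + half_bracket *\<^sub>R cross3 (T t) (U t)"
proof -
  have "struct_const j i k / 2 = - (struct_const i j k / 2)"
    "struct_const i k j / 2 = - (struct_const i j k / 2)" for i j k
    using struct_const_skew(1)[where i = i and j = j and k = k]
      struct_const_skew(2)[where i = i and j = j and k = k] by linarith+
  from alternating_form_cross3[OF this, of "T t" "U t"] show ?thesis
    by (simp add: cov_deriv_def connection_coeff[OF assms] half_bracket_def)
qed

end

section \<open>Frenet frames\<close>

text \<open>
  \<open>N \<times> B\<close> is a unit vector with \<open>T \<times> (N \<times> B) = 0\<close>, hence equal to \<open>T\<close> up to sign, and the sign
  is that of the determinant.  The other two identities follow from Lagrange's formula.
\<close>

lemma oriented_orthonormal_cross3: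
  fixes T N B :: "real^3"
  assumes "norm T = 1" "norm N = 1" "norm B = 1" "T \<bullet> N = 0" "T \<bullet> B = 0" "N \<bullet> B = 0"
    and "det (vector [T, N, B] :: real^3^3) > 0"
  shows "cross3 T N = B" "cross3 N B = T" "cross3 B T = N"
proof -
  have sq: "T \<bullet> T = 1" "N \<bullet> N = 1" "B \<bullet> B = 1"
    using assms by (simp_all add: dot_square_norm)
  let ?n = "cross3 N B"
  have "cross3 T ?n = 0" using assms by (simp add: Lagrange)
  moreover have n: "norm ?n = 1"
    using norm_cross_dot[of N B] assms by (simp add: power2_eq_1_iff) (smt (verit) norm_ge_zero)
  ultimately have "(T \<bullet> ?n)\<^sup>2 = 1" using norm_cross_dot[of T ?n] assms by simp
  moreover have "T \<bullet> ?n > 0" using assms by (simp add: dot_cross_det)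
  ultimately have "T \<bullet> ?n = 1" by (simp add: power2_eq_1_iff)
  then have "(T - ?n) \<bullet> (T - ?n) = 0"
    using dot_square_norm[of ?n] n
    by (simp add: inner_diff_left inner_diff_right sq inner_commute[of ?n T] del: inner_eq_zero_iff)
  then show NB: "cross3 N B = T" by simp
  show "cross3 B T = N"
    unfolding NB[symmetric] Lagrange using assms sq by (simp add: inner_commute)
  have "cross3 N T = - B"
    unfolding NB[symmetric] Lagrange using assms sq by (simp add: inner_commute)
  then show "cross3 T N = B" using cross_skew[of T N] by simp
qed

text \<open>
  Ensures that derivatives within the interval are unique, also at its endpoints.
\<close>

lemma nondegenerate_interval_not_isolated:
  assumes I: "nondegenerate_interval I" and t: "t \<in> I"
  shows "at t within I \<noteq> bot"
proof -
  obtain a b where ab: "a \<in> I" "b \<in> I" "a < b"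
    using I unfolding nondegenerate_interval_def by blast
  have "connected I" using I by (simp add: nondegenerate_interval_def is_interval_connected)
  then have "t islimpt I"
    using ab t by (intro connected_imp_perfect) (auto simp: is_singleton_def)
  then show ?thesis by (simp add: trivial_limit_within)
qed

lemma smooth_on_has_vector_derivative:
  assumes "smooth_on I U" "t \<in> I"
  shows "(U has_vector_derivative vector_derivative U (at t within I)) (at t within I)"
proof -
  have "Ck_on (Suc 0) I U" using assms(1) unfolding smooth_on_def by blast
  then have "U differentiable (at t within I)"
    using assms(2) by (simp add: differentiable_on_def)
  then show ?thesis by (rule vector_derivative_works[THEN iffD1])
qed

lemma frenet_apparatusD:
  assumes "frenet_apparatus X A g D E I \<gamma> T N B \<kappa> \<tau>" "t \<in> I"
  shows "\<kappa> t > 0"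
    and frenet_frame: "norm (T t) = 1" "norm (N t) = 1" "norm (B t) = 1"
      "T t \<bullet> N t = 0" "T t \<bullet> B t = 0" "N t \<bullet> B t = 0"
      "det (vector [T t, N t, B t] :: real^3^3) > 0"
    and frenet_equations: "cov_deriv g D E I \<gamma> T T t = \<kappa> t *\<^sub>R N t"
      "cov_deriv g D E I \<gamma> T N t = - \<kappa> t *\<^sub>R T t + \<tau> t *\<^sub>R B t"
      "cov_deriv g D E I \<gamma> T B t = - \<tau> t *\<^sub>R N t"
  using assms unfolding frenet_apparatus_def by blast+

lemma frenet_apparatus_cross:
  assumes "frenet_apparatus X A g D E I \<gamma> T N B \<kappa> \<tau>" "t \<in> I"
  shows "cross3 (T t) (N t) = B t" "cross3 (N t) (B t) = T t" "cross3 (B t) (T t) = N t"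
  by (rule oriented_orthonormal_cross3[OF frenet_frame[OF assms]])+

context framed_lie_group
begin

lemma lie_torsion_eq_half_bracket:
  assumes "frenet_apparatus X A g D E I \<gamma> T N B \<kappa> \<tau>" "t \<in> I"
  shows "lie_torsion G A g E T N B t = half_bracket"
proof -
  have "B t \<bullet> B t = 1" using frenet_frame(3)[OF assms] by (simp add: dot_square_norm)
  then show ?thesis
    by (simp add: lie_torsion_def alg_bracket_cross3 frenet_apparatus_cross[OF assms])
qed

text \<open>
  With the covariant derivative in the form \<open>U' + c (T \<times> U)\<close>, the term \<open>c (T \<times> U)\<close> vanishes for
  \<open>U = T\<close> and merely shifts the torsion by \<open>c\<close> for \<open>U = N\<close> and \<open>U = B\<close>.
\<close>

lemma frenet_derivatives:
  assumes D: "levi_civita X A g D"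
    and F: "frenet_apparatus X A g D E I \<gamma> T N B \<kappa> \<tau>" and t: "t \<in> I"
  shows "vector_derivative T (at t within I) = \<kappa> t *\<^sub>R N t"
    and "vector_derivative N (at t within I) = - \<kappa> t *\<^sub>R T t + (\<tau> t - half_bracket) *\<^sub>R B t"
    and "vector_derivative B (at t within I) = - (\<tau> t - half_bracket) *\<^sub>R N t"
proof -
  have "\<gamma> t \<in> carrier G"
    using F t continuous_map_image_subset_topspace[of "top_of_set I" X \<gamma>]
    unfolding frenet_apparatus_def unit_speed_curve_def smooth_curve_def topspace_X by auto
  note cov = cov_deriv_cross3[OF D, of \<gamma> t I, OF this]
  have BT: "cross3 (T t) (B t) = - N t"
    using frenet_apparatus_cross(3)[OF F t] cross_skew[of "T t" "B t"] by simp
  show "vector_derivative T (at t within I) = \<kappa> t *\<^sub>R N t"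
    "vector_derivative N (at t within I) = - \<kappa> t *\<^sub>R T t + (\<tau> t - half_bracket) *\<^sub>R B t"
    "vector_derivative B (at t within I) = - (\<tau> t - half_bracket) *\<^sub>R N t"
    using frenet_equations[OF F t]
    by (simp_all add: cov frenet_apparatus_cross[OF F t] BT algebra_simps eq_neg_iff_add_eq_0)
qed

text \<open>
  Comparing the derivatives of \<open>T\<^sub>s\<close> and \<open>B\<close> gives \<open>\<kappa>\<^sub>s\<close> and \<open>N\<^sub>s\<close>, and the cross product of
  \<open>T\<^sub>s\<close> and \<open>N\<^sub>s\<close> gives \<open>B\<^sub>s\<close>.  To differentiate \<open>B\<^sub>s = sgn (\<tau> - c) T\<close> one would first have to
  show that the sign is constant.  The relation \<open>B\<^sub>s \<bullet> N = 0\<close> holds for either sign, and its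
  derivative is \<open>sgn (\<tau> - c) (\<tau>\<^sub>s - c - \<kappa>) = 0\<close>.
\<close>

lemma conjugate_mate_apparatus:
  assumes D: "levi_civita X A g D" and I: "nondegenerate_interval I"
    and F: "frenet_apparatus X A g D E I \<gamma> T N B \<kappa> \<tau>"
    and Fs: "frenet_apparatus X A g D E I \<gamma>\<^sub>s T\<^sub>s N\<^sub>s B\<^sub>s \<kappa>\<^sub>s \<tau>\<^sub>s"
    and mate: "\<And>t. t \<in> I \<Longrightarrow> T\<^sub>s t = B t"
    and nz: "\<And>t. t \<in> I \<Longrightarrow> \<tau> t - half_bracket \<noteq> 0"
    and t: "t \<in> I"
  shows "\<kappa>\<^sub>s t = \<bar>\<tau> t - half_bracket\<bar>"
    and "N\<^sub>s t = - sgn (\<tau> t - half_bracket) *\<^sub>R N t"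
    and "B\<^sub>s t = sgn (\<tau> t - half_bracket) *\<^sub>R T t"
    and "\<tau>\<^sub>s t - half_bracket = \<kappa> t"
proof -
  have bot: "at t within I \<noteq> bot" using I t by (rule nondegenerate_interval_not_isolated)
  have smooth: "smooth_on I N" "smooth_on I B" "smooth_on I T\<^sub>s" "smooth_on I B\<^sub>s"
    using F Fs unfolding frenet_apparatus_def by blast+
  have N: "N\<^sub>s s = - sgn (\<tau> s - half_bracket) *\<^sub>R N s \<and> \<kappa>\<^sub>s s = \<bar>\<tau> s - half_bracket\<bar>" if s: "s \<in> I" for s
  proof -
    let ?a = "\<tau> s - half_bracket"
    \<comment> \<open>The functions \<open>T\<^sub>s\<close> and \<open>B\<close> agree on \<open>I\<close> only, so their derivatives are compared within \<open>I\<close>.\<close>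
    have "(T\<^sub>s has_vector_derivative vector_derivative B (at s within I)) (at s within I)"
      by (rule has_vector_derivative_transform[OF s _ smooth_on_has_vector_derivative[OF smooth(2) s]])
        (simp add: mate)
    then have "vector_derivative T\<^sub>s (at s within I) = vector_derivative B (at s within I)"
      using nondegenerate_interval_not_isolated[OF I s] by (intro vector_derivative_within)
    then have eq: "\<kappa>\<^sub>s s *\<^sub>R N\<^sub>s s = - ?a *\<^sub>R N s"
      by (simp only: frenet_derivatives[OF D F s] frenet_derivatives[OF D Fs s])
    have "norm (\<kappa>\<^sub>s s *\<^sub>R N\<^sub>s s) = \<bar>?a\<bar>"
      unfolding eq using frenet_frame(2)[OF F s] by simp
    then have k: "\<kappa>\<^sub>s s = \<bar>?a\<bar>" using frenet_apparatusD(1,3)[OF Fs s] by simp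
    have "\<bar>?a\<bar> *\<^sub>R N\<^sub>s s = \<bar>?a\<bar> *\<^sub>R (- sgn ?a *\<^sub>R N s)"
      using eq by (simp add: k abs_mult_sgn scaleR_left_diff_distrib)
    moreover have "\<bar>?a\<bar> \<noteq> 0" using nz[OF s] by simp
    ultimately show ?thesis using k scaleR_left_imp_eq by blast
  qed
  show "\<kappa>\<^sub>s t = \<bar>\<tau> t - half_bracket\<bar>" "N\<^sub>s t = - sgn (\<tau> t - half_bracket) *\<^sub>R N t"
    using N[OF t] by auto
  have Bs: "B\<^sub>s s = sgn (\<tau> s - half_bracket) *\<^sub>R T s" if s: "s \<in> I" for s
  proof -
    have "B\<^sub>s s = cross3 (B s) (N\<^sub>s s)"
      using frenet_apparatus_cross(1)[OF Fs s] mate[OF s] by simp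
    also have "\<dots> = sgn (\<tau> s - half_bracket) *\<^sub>R cross3 (N s) (B s)"
      using N[OF s] by (simp add: cross_mult_right cross_skew[of "B s"])
    finally show ?thesis by (simp add: frenet_apparatus_cross[OF F s])
  qed
  show "B\<^sub>s t = sgn (\<tau> t - half_bracket) *\<^sub>R T t" by (rule Bs[OF t])
  let ?s = "sgn (\<tau> t - half_bracket)"
  have "B\<^sub>s s \<bullet> N s = 0" if "s \<in> I" for s
    using frenet_frame(4)[OF F that] by (simp add: Bs[OF that])
  then have "((\<lambda>s. B\<^sub>s s \<bullet> N s) has_vector_derivative 0) (at t within I)"
    by (intro has_vector_derivative_transform[OF t _ has_vector_derivative_const]) auto
  moreover have "((\<lambda>s. B\<^sub>s s \<bullet> N s) has_vector_derivative
      (B\<^sub>s t \<bullet> vector_derivative N (at t within I) + vector_derivative B\<^sub>s (at t within I) \<bullet> N t)) (at t within I)"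
    using bounded_bilinear.has_vector_derivative[OF bounded_bilinear_inner
        smooth_on_has_vector_derivative[OF smooth(4) t] smooth_on_has_vector_derivative[OF smooth(1) t]] .
  ultimately have "B\<^sub>s t \<bullet> vector_derivative N (at t within I) + vector_derivative B\<^sub>s (at t within I) \<bullet> N t = 0"
    using vector_derivative_unique_within[OF bot] by metis
  then have "?s * (\<tau>\<^sub>s t - half_bracket - \<kappa> t) = 0"
    using N[OF t] frenet_frame[OF F t]
    by (simp add: frenet_derivatives[OF D F t] frenet_derivatives[OF D Fs t] Bs[OF t]
        inner_simps dot_square_norm algebra_simps)
  then show "\<tau>\<^sub>s t - half_bracket = \<kappa> t"
    using nz[OF t] by (simp add: sgn_zero_iff)
qed

end

theorem theorem6p1:
  fixes G :: "('a, 'b) monoid_scheme"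
    and X :: "'a topology"
    and A :: "('a, real^3) chart set"
    and g :: "('a, real^3) metric"
    and D :: "('a, real^3) connection"
    and E :: "3 \<Rightarrow> ('a, real^3) vfield"
    and I :: "real set"
    and \<gamma> \<gamma>\<^sub>s :: "real \<Rightarrow> 'a"
    and T N B T\<^sub>s N\<^sub>s B\<^sub>s :: "real \<Rightarrow> real^3"
    and \<kappa> \<tau> \<kappa>\<^sub>s \<tau>\<^sub>s \<tau>\<^sub>G \<tau>\<^sub>G\<^sub>s :: "real \<Rightarrow> real"
  defines "\<tau>\<^sub>G \<equiv> lie_torsion G A g E T N B"
    and "\<tau>\<^sub>G\<^sub>s \<equiv> lie_torsion G A g E T\<^sub>s N\<^sub>s B\<^sub>s"
  assumes "lie_group G X A"
    and "biinvariant_metric G X A g"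
    and "levi_civita X A g D"
    and "orthonormal_left_invariant_basis G A g E"
    and "nondegenerate_interval I"
    and "frenet_curve X A g D E I \<gamma> T N B \<kappa> \<tau>"
    and "\<forall>t\<in>I. \<tau> t - \<tau>\<^sub>G t \<noteq> 0"
    and "frenet_apparatus X A g D E I \<gamma>\<^sub>s T\<^sub>s N\<^sub>s B\<^sub>s \<kappa>\<^sub>s \<tau>\<^sub>s"
  shows "conjugate_mate X A g D E I B \<gamma>\<^sub>s T\<^sub>s N\<^sub>s B\<^sub>s \<kappa>\<^sub>s \<tau>\<^sub>s \<longleftrightarrow>
    (\<forall>t\<in>I.
       T\<^sub>s t = B t \<and>
       N\<^sub>s t = - sgn (\<tau> t - \<tau>\<^sub>G t) *\<^sub>R N t \<and>
       B\<^sub>s t = sgn (\<tau> t - \<tau>\<^sub>G t) *\<^sub>R T t \<and>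
       \<kappa>\<^sub>s t = \<bar>\<tau> t - \<tau>\<^sub>G t\<bar> \<and>
       \<tau>\<^sub>s t - \<tau>\<^sub>G\<^sub>s t = \<kappa> t \<and>
       \<tau>\<^sub>s t = \<kappa> t + \<tau>\<^sub>G t)"
proof -
  interpret framed_lie_group G X A g E
    by unfold_locales (fact assms)+
  have F: "frenet_apparatus X A g D E I \<gamma> T N B \<kappa> \<tau>"
    using assms by (simp add: frenet_curve_def)
  note Fs = assms(10)
  have \<tau>\<^sub>G: "\<tau>\<^sub>G t = half_bracket" if "t \<in> I" for t
    unfolding \<tau>\<^sub>G_def using F that by (rule lie_torsion_eq_half_bracket)
  have \<tau>\<^sub>G\<^sub>s: "\<tau>\<^sub>G\<^sub>s t = half_bracket" if "t \<in> I" for t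
    unfolding \<tau>\<^sub>G\<^sub>s_def using Fs that by (rule lie_torsion_eq_half_bracket)
  have nz: "\<tau> t - half_bracket \<noteq> 0" if "t \<in> I" for t
    using assms(9) that by (simp add: \<tau>\<^sub>G)
  show ?thesis
  proof
    assume "conjugate_mate X A g D E I B \<gamma>\<^sub>s T\<^sub>s N\<^sub>s B\<^sub>s \<kappa>\<^sub>s \<tau>\<^sub>s"
    then have mate: "T\<^sub>s t = B t" if "t \<in> I" for t
      using that by (simp add: conjugate_mate_def)
    note apparatus = conjugate_mate_apparatus[OF assms(5,7) F Fs mate nz]
    show "\<forall>t\<in>I.
       T\<^sub>s t = B t \<and>
       N\<^sub>s t = - sgn (\<tau> t - \<tau>\<^sub>G t) *\<^sub>R N t \<and>
       B\<^sub>s t = sgn (\<tau> t - \<tau>\<^sub>G t) *\<^sub>R T t \<and>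
       \<kappa>\<^sub>s t = \<bar>\<tau> t - \<tau>\<^sub>G t\<bar> \<and>
       \<tau>\<^sub>s t - \<tau>\<^sub>G\<^sub>s t = \<kappa> t \<and>
       \<tau>\<^sub>s t = \<kappa> t + \<tau>\<^sub>G t"
    proof (intro ballI conjI)
      fix t assume t: "t \<in> I"
      show "T\<^sub>s t = B t" by (rule mate[OF t])
      show "N\<^sub>s t = - sgn (\<tau> t - \<tau>\<^sub>G t) *\<^sub>R N t" "B\<^sub>s t = sgn (\<tau> t - \<tau>\<^sub>G t) *\<^sub>R T t"
        "\<kappa>\<^sub>s t = \<bar>\<tau> t - \<tau>\<^sub>G t\<bar>" "\<tau>\<^sub>s t - \<tau>\<^sub>G\<^sub>s t = \<kappa> t" "\<tau>\<^sub>s t = \<kappa> t + \<tau>\<^sub>G t"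
        using apparatus[OF _ _ t] t by (simp_all add: \<tau>\<^sub>G \<tau>\<^sub>G\<^sub>s)
    qed
  qed (use Fs in \<open>simp add: conjugate_mate_def\<close>)
qed

end
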